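(* The code $\mathcal{C}_0=\{3456,123,145,256,45,56,1,2,3,\emptyset\}\subseteq 2^{[6]}$ (where e.g. $3456$ denotes $\{3,4,5,6\}$) is minimally non-convex and has no local obstructions of the first or second kind.
   Context: A code is a subset $\mathcal{C}\subseteq 2^{[n]}$. For $\sigma\subseteq[n]$, $\mathrm{Tk}_{\mathcal{C}}(\sigma)=\{c\in\mathcal{C}\mid\sigma\subseteq c\}$; a trunk in $\mathcal{C}$ is a subset that is empty or of this form. A morphism $f:\mathcal{C}\to\mathcal{D}$ is a function such that preimages of trunks in $\mathcal{D}$ are trunks in $\mathcal{C}$; an isomorphism is a morphism whose inverse function is a morphism. Given $U_1,\dots,U_n\subseteq X$, $\mathrm{code}(\mathcal{U},X)=\{\sigma\subseteq[n]\mid \bigcap_{i\in\sigma}U_i\setminus\bigcup_{j\notin\sigma}U_j\neq\emptyset\}$, the empty intersection being $X$. A code is convex if it equals $\mathrm{code}(\mathcal{U},X)$ for some open convex $X\subseteq\mathbb{R}^d$ and convex open $U_i\subseteq X$. A code $\mathcal{C}$ is minimally non-convex if it is not convex, every trunk properly contained in $\mathcal{C}$ is convex, and every image $f(\mathcal{C})$ under a morphism that is not isomorphic to $\mathcal{C}$ is convex. $\Delta(\mathcal{C})$ denotes the simplicial complex consisting of all subsets of codewords of $\mathcal{C}$. $\mathcal{C}$ has a local obstruction (of the first kind) at $\sigma\in\Delta(\mathcal{C})\setminus\mathcal{C}$ if $\mathrm{link}_{\Delta(\mathcal{C})}(\sigma)$ is not contractible, and a local obstruction of the second kind at $\sigma\in\Delta(\mathcal{C})\setminus\mathcal{C}$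 if $\mathrm{link}_{\Delta(\mathcal{C})}(\sigma)$ is not collapsible. *)

theory Defs
  imports "HOL-Analysis.Analysis"
begin

section \<open>Codes, trunks and morphisms\<close>

text \<open>A code is a set of codewords, each a subset of [n] = {1..n} for some n.\<close>
definition is_code :: "nat set set \<Rightarrow> bool" where
  "is_code C \<longleftrightarrow> (\<exists>n. C \<subseteq> Pow {1..n})"

definition Tk :: "nat set set \<Rightarrow> nat set \<Rightarrow> nat set set" where
  "Tk C \<sigma> = {c \<in> C. \<sigma> \<subseteq> c}"

text \<open>A trunk: empty, or of the form Tk C sigma.  (For sigma not inside the ground set
  Tk C sigma is empty, so sigma may range over all finite sets of naturals.)\<close>
definition trunk :: "nat set set \<Rightarrow> nat set set \<Rightarrow> bool" where
  "trunk C T \<longleftrightarrow> T = {} \<or> (\<exists>\<sigma>. finite \<sigma> \<and> T = Tk C \<sigma>)"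

definition code_morphism :: "nat set set \<Rightarrow> nat set set \<Rightarrow> (nat set \<Rightarrow> nat set) \<Rightarrow> bool" where
  "code_morphism C D f \<longleftrightarrow> f ` C \<subseteq> D \<and> (\<forall>T. trunk D T \<longrightarrow> trunk C {c \<in> C. f c \<in> T})"

text \<open>An isomorphism is a morphism that is bijective and whose inverse function is a morphism.\<close>
definition code_isomorphic :: "nat set set \<Rightarrow> nat set set \<Rightarrow> bool" where
  "code_isomorphic C D \<longleftrightarrow> (\<exists>f g. code_morphism C D f \<and> code_morphism D C g \<and>
      (\<forall>c\<in>C. g (f c) = c) \<and> (\<forall>d\<in>D. f (g d) = d))"

section \<open>Convex codes\<close>

text \<open>code(U, X) for U_1,...,U_n; the empty intersection is X.\<close>
definition code_of :: "nat \<Rightarrow> (nat \<Rightarrow> 'a set) \<Rightarrow> 'a set \<Rightarrow> nat set set" where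
  "code_of n U X = {\<sigma>. \<sigma> \<subseteq> {1..n} \<and>
      ((\<Inter>i\<in>\<sigma>. U i) \<inter> X) - (\<Union>j\<in>{1..n} - \<sigma>. U j) \<noteq> {}}"

text \<open>Convexity of a set of points of R^d (as functions nat => real), written out.\<close>
definition convex_pts :: "(nat \<Rightarrow> real) set \<Rightarrow> bool" where
  "convex_pts S \<longleftrightarrow> (\<forall>x\<in>S. \<forall>y\<in>S. \<forall>t::real. 0 \<le> t \<and> t \<le> 1 \<longrightarrow>
      (\<lambda>i. (1 - t) * x i + t * y i) \<in> S)"

text \<open>R^d is modelled by the library's Euclidean_space d: functions nat => real vanishing
  at all indices >= d, with the Euclidean topology.\<close>
definition convex_code :: "nat set set \<Rightarrow> bool" where
  "convex_code C \<longleftrightarrow> (\<exists>n d (X :: (nat \<Rightarrow> real) set) U.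
      openin (Euclidean_space d) X \<and> convex_pts X \<and>
      (\<forall>i\<in>{1..n}. openin (Euclidean_space d) (U i) \<and> convex_pts (U i) \<and> U i \<subseteq> X) \<and>
      C = code_of n U X)"

definition minimally_non_convex :: "nat set set \<Rightarrow> bool" where
  "minimally_non_convex C \<longleftrightarrow>
     \<not> convex_code C \<and>
     (\<forall>T. trunk C T \<and> T \<subset> C \<longrightarrow> convex_code T) \<and>
     (\<forall>D f. is_code D \<and> code_morphism C D f \<and> \<not> code_isomorphic C (f ` C)
            \<longrightarrow> convex_code (f ` C))"

section \<open>Simplicial complexes, links, contractibility, collapsibility\<close>

definition Delta :: "nat set set \<Rightarrow> nat set set" where
  "Delta C = {\<tau>. \<exists>c\<in>C. \<tau> \<subseteq> c}"

definition link :: "nat set set \<Rightarrow> nat set \<Rightarrow> nat set set" where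
  "link K \<sigma> = {\<tau> \<in> K. \<tau> \<inter> \<sigma> = {} \<and> \<tau> \<union> \<sigma> \<in> K}"

text \<open>Geometric realization: vertex i goes to the i-th unit vector; the face tau
  spans the standard simplex on the coordinates in tau.\<close>
definition geom_simplex :: "nat set \<Rightarrow> (nat \<Rightarrow> real) set" where
  "geom_simplex \<tau> = {x. (\<forall>j. 0 \<le> x j) \<and> (\<forall>j. j \<notin> \<tau> \<longrightarrow> x j = 0) \<and> (\<Sum>j\<in>\<tau>. x j) = 1}"

definition realization :: "nat set set \<Rightarrow> (nat \<Rightarrow> real) set" where
  "realization K = (\<Union>\<tau>\<in>K - {{}}. geom_simplex \<tau>)"

text \<open>Contractible (a contractible space is nonempty).\<close>
definition complex_contractible :: "nat set set \<Rightarrow> bool" where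
  "complex_contractible K \<longleftrightarrow> realization K \<noteq> {} \<and>
     contractible_space (subtopology (powertop_real UNIV) (realization K))"

text \<open>Elementary collapse: remove a free face sigma (nonempty) together with the unique
  face tau of K properly containing it, where dim tau = dim sigma + 1.\<close>
definition elementary_collapse :: "nat set set \<Rightarrow> nat set set \<Rightarrow> bool" where
  "elementary_collapse K L \<longleftrightarrow> (\<exists>\<sigma> \<tau>. \<sigma> \<in> K \<and> \<tau> \<in> K \<and> \<sigma> \<noteq> {} \<and> \<sigma> \<subset> \<tau> \<and>
      finite \<tau> \<and> card \<tau> = card \<sigma> + 1 \<and> (\<forall>\<rho>\<in>K. \<sigma> \<subset> \<rho> \<longrightarrow> \<rho> = \<tau>) \<and>
      L = K - {\<sigma>, \<tau>})"

definition collapsible :: "nat set set \<Rightarrow> bool" where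
  "collapsible K \<longleftrightarrow> (\<exists>v. (elementary_collapse\<^sup>*\<^sup>*) K {{}, {v}})"

definition local_obstruction :: "nat set set \<Rightarrow> nat set \<Rightarrow> bool" where
  "local_obstruction C \<sigma> \<longleftrightarrow> \<sigma> \<in> Delta C - C \<and> \<not> complex_contractible (link (Delta C) \<sigma>)"

definition local_obstruction_2nd :: "nat set set \<Rightarrow> nat set \<Rightarrow> bool" where
  "local_obstruction_2nd C \<sigma> \<longleftrightarrow> \<sigma> \<in> Delta C - C \<and> \<not> collapsible (link (Delta C) \<sigma>)"

definition C0 :: "nat set set" where
  "C0 = {{3,4,5,6}, {1,2,3}, {1,4,5}, {2,5,6}, {4,5}, {5,6}, {1}, {2}, {3}, {}}"

end

theory Submission
  imports Defs
begin

text \<open>In a convex realization of \<open>C0\<close> write \<open>U\<^sub>i\<close> for the set of neuron \<open>i\<close>. The sets \<open>U\<^sub>1\<close>, \<open>U\<^sub>2\<close>, \<open>U\<^sub>3\<close>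
  have all pairwise intersections equal to one kernel (the codeword 123), and \<open>U\<^sub>5 = U\<^sub>4 \<union> U\<^sub>6\<close> is convex.
  Joining a point with codeword 145 to one with codeword 256 inside \<open>U\<^sub>5\<close>, connectedness gives a point of
  \<open>U\<^sub>4 \<inter> U\<^sub>6 \<subseteq> U\<^sub>3\<close> between them. So three petals have collinear points, and a supporting hyperplane of the
  kernel shows that the middle one lies in the kernel, which misses \<open>U\<^sub>5\<close>.

  A proper image is determined by a family of trunks that omits one of the six simple trunks
  \<open>Tk C0 {r}\<close>. For each \<open>r\<close> we exhibit an open convex set in \<open>\<real>\<^sup>3\<close> labelled by codewords such that every trunk
  other than \<open>Tk C0 {r}\<close> pulls back to a convex open set; this also realizes all proper trunks.

  Each link of a missing face is a simplex, a triangle with one edge attached, or a triangle with two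
  edges attached.\<close>

section \<open>Non-convexity\<close>

text \<open>If \<open>p\<close> were not strictly on the side of \<open>K\<close>, the segment from
  \<open>q\<close> to \<open>p\<close> would meet the hyperplane in a point \<open>r\<close> of
  \<open>P\<close>. The segment from \<open>r\<close> to \<open>z\<close> stays in the hyperplane
  and, short of \<open>z\<close>, in \<open>P\<close>. Near \<open>z\<close> it is also in
  \<open>C\<close>, hence in \<open>K\<close>, which misses the hyperplane.\<close>

lemma no_crossing_at_supporting_hyperplane:
  fixes P C K :: "'a::euclidean_space set"
  assumes "open P" "convex P" "open C" "P \<inter> C = K" "q \<in> K" "p \<in> P" "z \<in> closure K" "z \<in> C"
    and v: "\<And>y. y \<in> K \<Longrightarrow> v \<bullet> z < v \<bullet> y"
  shows "v \<bullet> z < v \<bullet> p"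
proof (rule ccontr)
  assume "\<not> v \<bullet> z < v \<bullet> p"
  then have vp: "v \<bullet> p \<le> v \<bullet> z" by simp
  have vq: "v \<bullet> z < v \<bullet> q" using v \<open>q \<in> K\<close> by simp
  \<comment> \<open>The parameter at which the segment from \<open>q\<close> to \<open>p\<close>
    crosses the hyperplane through \<open>z\<close> with normal \<open>v\<close>.\<close>
  define l where "l = (v \<bullet> q - v \<bullet> z) / (v \<bullet> q - v \<bullet> p)"
  define r where "r = (1 - l) *\<^sub>R q + l *\<^sub>R p"
  have l: "0 \<le> l" "l \<le> 1" using vp vq by (auto simp: l_def field_simps)
  have "q \<in> P" using assms by auto
  then have rP: "r \<in> P" using \<open>convex P\<close> l \<open>p \<in> P\<close> unfolding r_def convex_alt by blast
  have "v \<bullet> r = v \<bullet> q - l * (v \<bullet> q - v \<bullet> p)"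
    by (simp add: r_def inner_add_right algebra_simps)
  also have "\<dots> = v \<bullet> z" using vp vq by (simp add: l_def)
  finally have vr: "v \<bullet> r = v \<bullet> z" .
  have "z \<notin> K" using v by blast
  have "r \<noteq> z" using rP \<open>z \<in> C\<close> \<open>z \<notin> K\<close> assms(4) by blast
  have "closure K \<subseteq> closure P" using assms(4) by (intro closure_mono) auto
  then have seg: "open_segment r z \<subseteq> P"
    using in_interior_closure_convex_segment[of P r z] assms rP by (auto simp: interior_open)
  have "z \<in> closure (open_segment r z)" using \<open>r \<noteq> z\<close> by simp
  then obtain w where w: "w \<in> C" "w \<in> open_segment r z"
    using \<open>open C\<close> \<open>z \<in> C\<close> by (meson closure_iff_nhds_not_empty disjoint_iff order_refl)
  then have "w \<in> K" using seg assms(4) by auto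
  moreover obtain u where "w = (1 - u) *\<^sub>R r + u *\<^sub>R z"
    using w by (auto simp: in_segment)
  then have "v \<bullet> w = v \<bullet> z" using vr by (simp add: inner_add_right left_diff_distrib)
  ultimately show False using v by force
qed

text \<open>If \<open>c\<close> were outside \<open>K\<close>, the segment from \<open>q\<close> to
  \<open>c\<close> would leave \<open>K\<close> at a frontier point \<open>z\<close> of
  \<open>K\<close>, still in \<open>C\<close>. A supporting hyperplane at \<open>z\<close> has
  \<open>a\<close> and \<open>b\<close> strictly on the side of \<open>K\<close>, hence also
  \<open>c\<close>, and then \<open>z\<close> itself, being between \<open>q\<close> and
  \<open>c\<close>.\<close>

lemma middle_petal_point_in_kernel:
  fixes A B C K :: "'a::euclidean_space set"
  assumes A: "open A" "convex A" and B: "open B" "convex B" and C: "open C" "convex C"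
    and AC: "A \<inter> C = K" and BC: "B \<inter> C = K"
    and q: "q \<in> K" and abc: "a \<in> A" "b \<in> B" "c \<in> C" and c: "c \<in> closed_segment a b"
  shows "c \<in> K"
proof (rule ccontr)
  assume "c \<notin> K"
  then have "closed_segment q c \<inter> frontier K \<noteq> {}"
    using q by (intro connected_Int_frontier) auto
  then obtain z where z: "z \<in> closed_segment q c" "z \<in> frontier K" by auto
  have K: "open K" "convex K" using AC A C by (auto intro: convex_Int)
  have zK: "z \<in> closure K" "z \<notin> K" using z K by (auto simp: frontier_def interior_open)
  have "q \<in> C" using q AC by auto
  then have zC: "z \<in> C" using z C abc by (meson convex_contains_segment subsetD)
  obtain v where v: "\<And>y. y \<in> K \<Longrightarrow> v \<bullet> z < v \<bullet> y"
    using supporting_hyperplane_relative_frontier[of K z] K zK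
    by (metis rel_interior_open)
  obtain t where t: "0 \<le> t" "t \<le> 1" "z = (1 - t) *\<^sub>R q + t *\<^sub>R c"
    using z by (auto simp: in_segment)
  obtain s where s: "0 \<le> s" "s \<le> 1" "c = (1 - s) *\<^sub>R a + s *\<^sub>R b"
    using c by (auto simp: in_segment)
  have "t \<noteq> 0" using t q zK by auto
  have a: "v \<bullet> z < v \<bullet> a"
    using no_crossing_at_supporting_hyperplane[of A C K q a z v] A C AC q abc zK zC v by auto
  have b: "v \<bullet> z < v \<bullet> b"
    using no_crossing_at_supporting_hyperplane[of B C K q b z v] B C BC q abc zK zC v by auto
  have conv: "w < (1 - u) * x + u * y" if "0 \<le> u" "u \<le> 1" "w < x" "w < y" for u w x y :: real
    using that convex_bound_lt[of "-x" "-w" "-y" "1-u" u] by simp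
  have "v \<bullet> z < v \<bullet> c" using conv[OF s(1,2) a b] s(3) by (simp add: inner_add_right)
  then have "v \<bullet> z < v \<bullet> z" using conv[OF t(1,2) v[OF q]] t(3) by (metis inner_add_right inner_scaleR_right)
  then show False by simp
qed

section \<open>Pulling a realization back to a plane\<close>

text \<open>All points that matter lie in the affine plane of \<open>p1\<close>, \<open>p2\<close>,
  \<open>q\<close>, which become (0,0), (1,0), (0,1). This moves the argument to the type
  \<open>real \<times> real\<close>, where the petal lemma applies. Injectivity is irrelevant, as
  only preimages are taken.\<close>

definition plane_map :: "(nat \<Rightarrow> real) \<Rightarrow> (nat \<Rightarrow> real) \<Rightarrow> (nat \<Rightarrow> real) \<Rightarrow> real \<times> real \<Rightarrow> nat \<Rightarrow> real" where
  "plane_map p1 p2 q w = (\<lambda>i. p1 i + fst w * (p2 i - p1 i) + snd w * (q i - p1 i))"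

lemma continuous_plane_map:
  assumes "p1 \<in> topspace (Euclidean_space d)" "p2 \<in> topspace (Euclidean_space d)"
    "q \<in> topspace (Euclidean_space d)"
  shows "continuous_map euclidean (Euclidean_space d) (plane_map p1 p2 q)"
  using assms unfolding plane_map_def Euclidean_space_def
  by (auto simp: continuous_map_in_subtopology continuous_map_componentwise_UNIV
      intro!: continuous_intros)

lemma plane_map_vimage:
  assumes "p1 \<in> topspace (Euclidean_space d)" "p2 \<in> topspace (Euclidean_space d)"
    "q \<in> topspace (Euclidean_space d)" "openin (Euclidean_space d) U" "convex_pts U"
  shows "open (plane_map p1 p2 q -` U)" "convex (plane_map p1 p2 q -` U)"
proof -
  show "open (plane_map p1 p2 q -` U)"
    using openin_continuous_map_preimage[OF continuous_plane_map[OF assms(1-3)] assms(4)]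
    by (simp add: vimage_def)
  have "plane_map p1 p2 q ((1 - t) *\<^sub>R x + t *\<^sub>R y)
      = (\<lambda>i. (1 - t) * plane_map p1 p2 q x i + t * plane_map p1 p2 q y i)" for t x y
    by (auto simp: plane_map_def algebra_simps)
  then show "convex (plane_map p1 p2 q -` U)"
    using assms(5) by (auto simp: convex_alt convex_pts_def)
qed

lemma code_of_iff:
  "\<sigma> \<in> code_of n U X \<longleftrightarrow> (\<exists>x\<in>X. \<sigma> = {i \<in> {1..n}. x \<in> U i})"
  unfolding code_of_def by fastforce

lemma C0_not_convex: "\<not> convex_code C0"
proof
  assume "convex_code C0"
  then obtain n d X U where
    U: "\<And>i. i \<in> {1..n} \<Longrightarrow> openin (Euclidean_space d) (U i) \<and> convex_pts (U i) \<and> U i \<subseteq> X"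
    and X: "openin (Euclidean_space d) X" and C: "C0 = code_of n U X"
    unfolding convex_code_def by blast
  have word: "{i \<in> {1..n}. x \<in> U i} \<in> C0" if "x \<in> X" for x
    unfolding C code_of_iff using that by blast
  have pt: "\<exists>x\<in>X. c = {i \<in> {1..n}. x \<in> U i}" if "c \<in> C0" for c
    using that unfolding C code_of_iff .
  have XE: "x \<in> topspace (Euclidean_space d)" if "x \<in> X" for x
    using that X openin_subset by blast
  obtain q where q: "q \<in> X" "{1,2,3} = {i \<in> {1..n}. q \<in> U i}" using pt[of "{1,2,3}"] by (auto simp: C0_def)
  obtain p1 where p1: "p1 \<in> X" "{1,4,5} = {i \<in> {1..n}. p1 \<in> U i}" using pt[of "{1,4,5}"] by (auto simp: C0_def)
  obtain p2 where p2: "p2 \<in> X" "{2,5,6} = {i \<in> {1..n}. p2 \<in> U i}" using pt[of "{2,5,6}"] by (auto simp: C0_def)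
  \<comment> \<open>\<open>n\<close> comes from the assumed realization; these three codewords
    together force it to be at least 6.\<close>
  have n: "{1,2,3,4,5,6} \<subseteq> {1..n}" using q(2) p1(2) p2(2) by blast
  have wd: "i \<in> c \<longleftrightarrow> x \<in> U i" if "c = {i \<in> {1..n}. x \<in> U i}" "i \<in> {1,2,3,4,5,6}" for i c x
    using that n by blast
  let ?w = "\<lambda>x. {i \<in> {1..n}. x \<in> U i}"
  have UX: "U i \<subseteq> X" if "i \<in> {1,2,3,4,5,6}" for i using U that n by blast
  \<comment> \<open>The properties common to all codewords that enter the argument: the shared
    kernel of the petals, away from neuron 5, and the cover of neuron 5 by neurons 4 and 6 with
    overlap inside neuron 3.\<close>
  have C0_facts: "\<forall>c\<in>C0. (1 \<in> c \<and> 3 \<in> c \<longleftrightarrow> 2 \<in> c \<and> 3 \<in> c) \<and> \<not> (1 \<in> c \<and> 3 \<in> c \<and> 5 \<in> c)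
      \<and> (5 \<in> c \<longleftrightarrow> 4 \<in> c \<or> 6 \<in> c) \<and> (4 \<in> c \<and> 6 \<in> c \<longrightarrow> 3 \<in> c)"
    by (simp add: C0_def)
  have inw: "1 \<in> ?w x \<longleftrightarrow> x \<in> U 1" "2 \<in> ?w x \<longleftrightarrow> x \<in> U 2" "3 \<in> ?w x \<longleftrightarrow> x \<in> U 3"
    "4 \<in> ?w x \<longleftrightarrow> x \<in> U 4" "5 \<in> ?w x \<longleftrightarrow> x \<in> U 5" "6 \<in> ?w x \<longleftrightarrow> x \<in> U 6" for x
    using n by blast+
  \<comment> \<open>The plane may leave \<open>X\<close>, so the facts are extended to all points:
    outside \<open>X\<close> every membership in them is false.\<close>
  have facts: "(x \<in> U 1 \<and> x \<in> U 3 \<longleftrightarrow> x \<in> U 2 \<and> x \<in> U 3) \<and> \<not> (x \<in> U 1 \<and> x \<in> U 3 \<and> x \<in> U 5)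
      \<and> (x \<in> U 5 \<longleftrightarrow> x \<in> U 4 \<or> x \<in> U 6) \<and> (x \<in> U 4 \<and> x \<in> U 6 \<longrightarrow> x \<in> U 3)" for x
  proof (cases "x \<in> X")
    case True
    show ?thesis using bspec[OF C0_facts word[OF True]] unfolding inw .
  next
    case False
    then have "x \<notin> U i" if "i \<in> {1,2,3,4,5,6}" for i using UX[OF that] by blast
    then show ?thesis by simp
  qed
  define V where "V = (\<lambda>i. plane_map p1 p2 q -` U i)"
  have V: "open (V i)" "convex (V i)" if "i \<in> {1,2,3,4,5,6}" for i
    using plane_map_vimage[of p1 d p2 q "U i"] that n U XE p1(1) p2(1) q(1) unfolding V_def by blast+
  have e: "plane_map p1 p2 q (0,0) = p1" "plane_map p1 p2 q (1,0) = p2" "plane_map p1 p2 q (0,1) = q"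
    by (auto simp: plane_map_def)
  let ?S = "closed_segment (0,0) (1,0) :: (real \<times> real) set"
  have mem: "(0,0) \<in> V 1" "(0,0) \<in> V 4" "(0,0) \<in> V 5" "(1,0) \<in> V 2" "(1,0) \<in> V 5" "(1,0) \<in> V 6"
    "(0,1) \<in> V 1" "(0,1) \<in> V 3"
    unfolding V_def vimage_eq e wd[OF p1(2), symmetric]
    using wd[OF p1(2)] wd[OF p2(2)] wd[OF q(2)] by auto
  have "?S \<subseteq> V 5" using V[of 5] mem by (simp add: closed_segment_subset)
  then have "?S \<subseteq> V 4 \<union> V 6" using facts by (auto simp: V_def)
  \<comment> \<open>The segment is connected and covered by two open sets, each containing one of
    its ends.\<close>
  then have "V 4 \<inter> V 6 \<inter> ?S \<noteq> {}"
    using connectedD[OF connected_segment(1), of "V 4" "V 6" "(0,0)" "(1,0)"] V mem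
      ends_in_segment(1)[of "(0::real,0::real)" "(1,0)"] ends_in_segment(2)[of "(1::real,0::real)" "(0,0)"]
    by blast
  then obtain c where c: "c \<in> V 4" "c \<in> V 6" "c \<in> ?S" by auto
  have "c \<in> V 3" using c facts by (auto simp: V_def)
  \<comment> \<open>The middle petal is \<open>V 3\<close>; (0,1), the point over 123, is the kernel
    point, and \<open>c\<close> lies between points of \<open>V 1\<close> and
    \<open>V 2\<close>.\<close>
  have "c \<in> V 1 \<inter> V 3"
    by (rule middle_petal_point_in_kernel[of "V 1" "V 2" "V 3" _ "(0,1)" "(0,0)" "(1,0)"])
      (use V mem c facts \<open>c \<in> V 3\<close> in \<open>auto simp: V_def\<close>)
  moreover have "c \<in> V 5" using c \<open>?S \<subseteq> V 5\<close> by auto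
  ultimately show False using facts by (auto simp: V_def)
qed

section \<open>Links of missing faces\<close>

text \<open>The straight-line homotopy, whose continuity is checked coordinatewise. \<open>S\<close>
  need not be convex, since only the segments from \<open>f x\<close> to \<open>g x\<close> are
  travelled.\<close>

lemma homotopic_linear_powertop_real:
  fixes f g :: "'a \<Rightarrow> 'b \<Rightarrow> real"
  assumes f: "continuous_map X (subtopology (powertop_real UNIV) S) f"
    and g: "continuous_map X (subtopology (powertop_real UNIV) S) g"
    and S: "\<And>x t. x \<in> topspace X \<Longrightarrow> 0 \<le> t \<Longrightarrow> t \<le> 1 \<Longrightarrow> (\<lambda>i. (1 - t) * f x i + t * g x i) \<in> S"
  shows "homotopic_with (\<lambda>_. True) X (subtopology (powertop_real UNIV) S) f g"
proof -
  have comp: "continuous_map X euclideanreal (\<lambda>x. h x i)"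
    if "continuous_map X (subtopology (powertop_real UNIV) S) h" for h :: "'a \<Rightarrow> 'b \<Rightarrow> real" and i
    using that by (simp add: continuous_map_in_subtopology continuous_map_componentwise_UNIV)
  have snd: "continuous_map (prod_topology (top_of_set {0..1::real}) X) euclideanreal (\<lambda>p. h (snd p))"
    if "continuous_map X euclideanreal h" for h
    using continuous_map_compose[OF continuous_map_snd that] by (simp add: o_def)
  have fst: "continuous_map (prod_topology (top_of_set {0..1::real}) X) euclideanreal fst"
    using continuous_map_fst continuous_map_in_subtopology by blast
  show ?thesis
    unfolding homotopic_with_def
    by (rule exI[of _ "\<lambda>(t, x) i. (1 - t) * f x i + t * g x i"])
      (auto simp: continuous_map_in_subtopology continuous_map_componentwise_UNIV case_prod_unfold
        intro!: S continuous_intros snd comp fst f g)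
qed

text \<open>The simplicial map induced by the vertex map \<open>\<rho>\<close>, in barycentric
  coordinates: the weight of each vertex moves to its image.\<close>

definition push :: "'v set \<Rightarrow> ('v \<Rightarrow> 'v) \<Rightarrow> ('v \<Rightarrow> real) \<Rightarrow> 'v \<Rightarrow> real" where
  "push V \<rho> x = (\<lambda>j. \<Sum>i\<in>V. if \<rho> i = j then x i else 0)"

lemma continuous_push:
  assumes "finite V"
  shows "continuous_map (powertop_real UNIV) (powertop_real UNIV) (push V \<rho>)"
proof -
  have "continuous_map (powertop_real UNIV) euclideanreal (\<lambda>x. if b then x i else 0)" for b and i :: 'v
    by (cases b) (auto intro: continuous_map_product_projection)
  then show ?thesis
    unfolding push_def continuous_map_componentwise_UNIV
    using assms by (intro allI continuous_map_sum)
qed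

lemma push_geom_simplex:
  assumes "x \<in> geom_simplex \<tau>" "\<tau> \<subseteq> V" "finite V"
  shows "push V \<rho> x \<in> geom_simplex (\<rho> ` \<tau>)"
proof -
  have x: "0 \<le> x j" "j \<notin> \<tau> \<Longrightarrow> x j = 0" "(\<Sum>j\<in>\<tau>. x j) = 1" for j
    using assms(1) by (auto simp: geom_simplex_def)
  have fin: "finite \<tau>" using assms finite_subset by blast
  have push: "push V \<rho> x j = (\<Sum>i\<in>\<tau>. if \<rho> i = j then x i else 0)" for j
    unfolding push_def by (rule sum.mono_neutral_right) (use assms x in auto)
  have "(\<Sum>j\<in>\<rho> ` \<tau>. push V \<rho> x j) = (\<Sum>i\<in>\<tau>. \<Sum>j\<in>\<rho> ` \<tau>. if \<rho> i = j then x i else 0)"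
    unfolding push by (rule sum.swap)
  also have "\<dots> = (\<Sum>i\<in>\<tau>. x i)"
    using fin by (intro sum.cong) (auto simp: sum.delta')
  finally have "(\<Sum>j\<in>\<rho> ` \<tau>. push V \<rho> x j) = 1" using x by simp
  moreover have "0 \<le> push V \<rho> x j" for j
    unfolding push by (intro sum_nonneg) (use x in auto)
  moreover have "push V \<rho> x j = 0" if "j \<notin> \<rho> ` \<tau>" for j
    unfolding push by (intro sum.neutral) (use that in auto)
  ultimately show ?thesis by (simp add: geom_simplex_def)
qed

lemma geom_simplex_mono:
  assumes "\<sigma> \<subseteq> \<tau>" "finite \<tau>"
  shows "geom_simplex \<sigma> \<subseteq> geom_simplex \<tau>"
proof
  fix x assume x: "x \<in> geom_simplex \<sigma>"
  then have "(\<Sum>j\<in>\<tau>. x j) = (\<Sum>j\<in>\<sigma>. x j)"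
    using assms by (intro sum.mono_neutral_right) (auto simp: geom_simplex_def)
  with x assms show "x \<in> geom_simplex \<tau>" by (auto simp: geom_simplex_def)
qed

lemma geom_simplex_convex:
  assumes "x \<in> geom_simplex \<tau>" "y \<in> geom_simplex \<tau>" "0 \<le> t" "t \<le> 1"
  shows "(\<lambda>i. (1 - t) * x i + t * y i) \<in> geom_simplex \<tau>"
  using assms by (auto simp: geom_simplex_def sum.distrib simp flip: sum_distrib_left)

text \<open>Contiguous vertex maps induce homotopic maps of realizations.\<close>

lemma homotopic_push:
  assumes V: "finite V" "\<And>\<tau>. \<tau> \<in> K \<Longrightarrow> \<tau> \<subseteq> V"
    and cont: "\<And>\<tau>. \<tau> \<in> K \<Longrightarrow> \<rho> ` \<tau> \<union> \<rho>' ` \<tau> \<in> K"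
  shows "homotopic_with (\<lambda>_. True) (subtopology (powertop_real UNIV) (realization K))
           (subtopology (powertop_real UNIV) (realization K)) (push V \<rho>) (push V \<rho>')"
proof -
  let ?R = "realization K"
  have seg: "(\<lambda>i. (1 - t) * push V \<rho> x i + t * push V \<rho>' x i) \<in> ?R"
    if x: "x \<in> ?R" and t: "0 \<le> t" "t \<le> 1" for x t
  proof -
    obtain \<tau> where \<tau>: "\<tau> \<in> K" "\<tau> \<noteq> {}" "x \<in> geom_simplex \<tau>"
      using x by (auto simp: realization_def)
    \<comment> \<open>A face carrying both images of \<open>x\<close>; its simplex is convex and so
      contains the segment between them.\<close>
    let ?u = "\<rho> ` \<tau> \<union> \<rho>' ` \<tau>"
    have u: "?u \<in> K" "finite ?u" "?u \<noteq> {}"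
      using cont[OF \<tau>(1)] V finite_subset \<tau> by blast+
    have "push V r x \<in> geom_simplex ?u" if "r ` \<tau> \<subseteq> ?u" for r
      using push_geom_simplex[OF \<tau>(3) V(2)[OF \<tau>(1)] V(1), of r] geom_simplex_mono[OF that u(2)] by auto
    then have "(\<lambda>i. (1 - t) * push V \<rho> x i + t * push V \<rho>' x i) \<in> geom_simplex ?u"
      using t by (intro geom_simplex_convex) auto
    then show ?thesis using u unfolding realization_def by blast
  qed
  \<comment> \<open>The ends t = 0 and t = 1 of the segment are the two images themselves.\<close>
  have mem: "push V \<rho> x \<in> ?R" "push V \<rho>' x \<in> ?R" if "x \<in> ?R" for x
    using seg[OF that, of 0] seg[OF that, of 1] by auto
  have "continuous_map (subtopology (powertop_real UNIV) ?R) (subtopology (powertop_real UNIV) ?R) (push V r)"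
    if "\<And>x. x \<in> ?R \<Longrightarrow> push V r x \<in> ?R" for r
    using that continuous_push[OF V(1), of r]
    by (auto simp: continuous_map_in_subtopology continuous_map_from_subtopology)
  then show ?thesis using mem seg
    by (intro homotopic_linear_powertop_real) auto
qed

text \<open>The identity is contiguous to \<open>\<rho>\<close> and \<open>\<rho>\<close> to the
  constant map at \<open>v\<close>, so the identity of the realization is homotopic to a
  constant.\<close>

lemma contractible_if_contiguous:
  assumes V: "finite V" "\<And>\<tau>. \<tau> \<in> K \<Longrightarrow> \<tau> \<subseteq> V" and "{v} \<in> K"
    and id: "\<And>\<tau>. \<tau> \<in> K \<Longrightarrow> \<tau> \<union> \<rho> ` \<tau> \<in> K"
    and const: "\<And>\<tau>. \<tau> \<in> K \<Longrightarrow> insert v (\<rho> ` \<tau>) \<in> K"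
  shows "complex_contractible K"
proof -
  let ?T = "subtopology (powertop_real UNIV) (realization K)"
  define e where "e = (\<lambda>j. if j = v then 1 else 0 :: real)"
  have "e \<in> geom_simplex {v}" by (simp add: e_def geom_simplex_def)
  then have e: "e \<in> realization K" using \<open>{v} \<in> K\<close> by (auto simp: realization_def)
  \<comment> \<open>On the empty face the constant map has empty image instead of
    \<open>{v}\<close>. Dropping this face leaves the realization unchanged.\<close>
  let ?K = "K - {{}}"
  have 1: "homotopic_with (\<lambda>_. True) ?T ?T (push V id) (push V \<rho>)"
    by (rule homotopic_push) (use V id in auto)
  have R: "realization ?K = realization K" by (simp add: realization_def)
  have 2: "homotopic_with (\<lambda>_. True) ?T ?T (push V \<rho>) (push V (\<lambda>_. v))"
  proof -
    have "\<rho> ` \<tau> \<union> (\<lambda>_. v) ` \<tau> \<in> ?K" if "\<tau> \<in> ?K" for \<tau>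
    proof -
      have "\<rho> ` \<tau> \<union> (\<lambda>_. v) ` \<tau> = insert v (\<rho> ` \<tau>)" using that by auto
      then show ?thesis using const[of \<tau>] that by simp
    qed
    then show ?thesis using homotopic_push[of V ?K \<rho> "\<lambda>_. v"] V unfolding R by auto
  qed
  have supp: "x j = 0" if "x \<in> realization K" "j \<notin> V" for x j
    using that V(2) by (auto simp: realization_def geom_simplex_def)
  have sum1: "(\<Sum>j\<in>V. x j) = 1" if x: "x \<in> realization K" for x
  proof -
    obtain \<tau> where "\<tau> \<in> K" "x \<in> geom_simplex \<tau>" using x by (auto simp: realization_def)
    then show ?thesis using V geom_simplex_mono[of \<tau> V] by (auto simp: geom_simplex_def)
  qed
  have idp: "push V id x = x" if "x \<in> realization K" for x
    using supp[OF that] V(1) by (auto simp: push_def fun_eq_iff)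
  have cp: "push V (\<lambda>_. v) x = e" if "x \<in> realization K" for x
    using sum1[OF that] by (auto simp: push_def e_def fun_eq_iff)
  have "homotopic_with (\<lambda>_. True) ?T ?T (push V id) (push V (\<lambda>_. v))"
    using 1 2 homotopic_with_trans by blast
  then have "homotopic_with (\<lambda>_. True) ?T ?T id (\<lambda>_. e)"
    by (rule homotopic_with_eq) (auto simp: idp cp)
  then show ?thesis using e unfolding complex_contractible_def contractible_space_def by auto
qed

section \<open>Elementary collapses\<close>

lemma collapsible_point: "collapsible {{}, {v}}"
  unfolding collapsible_def by blast

text \<open>Builds collapses backwards: no face of \<open>L\<close> contains
  \<open>\<sigma>\<close>, so in the larger complex its only proper coface is
  \<open>insert v \<sigma>\<close>.\<close>

lemma collapsible_insert:
  assumes "collapsible L" "finite \<sigma>" "\<sigma> \<noteq> {}" "v \<notin> \<sigma>" and free: "\<forall>\<rho>\<in>L. \<not> \<sigma> \<subseteq> \<rho>"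
  shows "collapsible (insert \<sigma> (insert (insert v \<sigma>) L))"
proof -
  let ?K = "insert \<sigma> (insert (insert v \<sigma>) L)"
  have "L = ?K - {\<sigma>, insert v \<sigma>}" using free by blast
  moreover have "\<forall>\<rho>\<in>?K. \<sigma> \<subset> \<rho> \<longrightarrow> \<rho> = insert v \<sigma>" using free by blast
  moreover have "card (insert v \<sigma>) = card \<sigma> + 1" using assms by simp
  moreover have "\<sigma> \<subset> insert v \<sigma>" "finite (insert v \<sigma>)" using assms by auto
  ultimately have "elementary_collapse ?K L"
    unfolding elementary_collapse_def using assms(3) by blast
  with assms(1) show ?thesis
    unfolding collapsible_def by (blast intro: converse_rtranclp_into_rtranclp)
qed

section \<open>Links in the simplicial complex of \<open>C0\<close>\<close>

text \<open>One full simplex for each codeword above \<open>\<sigma>\<close>; for a concrete code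
  this can be evaluated by simplification.\<close>

lemma link_Delta:
  "link (Delta C) \<sigma> = (\<Union>c\<in>C. if \<sigma> \<subseteq> c then Pow (c - \<sigma>) else {})"
proof (intro set_eqI iffI)
  fix \<tau> assume "\<tau> \<in> link (Delta C) \<sigma>"
  then obtain c where "c \<in> C" "\<tau> \<union> \<sigma> \<subseteq> c" "\<tau> \<inter> \<sigma> = {}" unfolding link_def Delta_def by blast
  then have "c \<in> C \<and> \<sigma> \<subseteq> c \<and> \<tau> \<subseteq> c - \<sigma>" by blast
  then show "\<tau> \<in> (\<Union>c\<in>C. if \<sigma> \<subseteq> c then Pow (c - \<sigma>) else {})" by auto
next
  fix \<tau> assume "\<tau> \<in> (\<Union>c\<in>C. if \<sigma> \<subseteq> c then Pow (c - \<sigma>) else {})"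
  then obtain c where "c \<in> C" "\<sigma> \<subseteq> c" "\<tau> \<subseteq> c - \<sigma>" by (auto split: if_splits)
  then have "c \<in> C \<and> \<tau> \<subseteq> c \<and> \<tau> \<inter> \<sigma> = {} \<and> \<tau> \<union> \<sigma> \<subseteq> c" by blast
  then show "\<tau> \<in> link (Delta C) \<sigma>" unfolding link_def Delta_def by blast
qed

text \<open>Every face lies in one of the four maximal codewords, so it is enough to list their
  subsets and discard the codewords.\<close>

lemma missing_faces_C0:
  assumes "\<sigma> \<in> Delta C0 - C0"
  shows "\<sigma> \<in> {{4}, {5}, {6}, {3,4}, {3,5}, {3,6}, {4,6}, {1,2}, {1,3}, {2,3}, {1,4}, {1,5},
    {2,5}, {2,6}, {3,4,5}, {3,4,6}, {3,5,6}, {4,5,6}}"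
proof -
  have "\<sigma> \<in> Delta C0" and "\<sigma> \<notin> C0" using assms by auto
  from this(1) have "\<sigma> \<in> Pow {3,4,5,6} \<or> \<sigma> \<in> Pow {1,2,3} \<or> \<sigma> \<in> Pow {1,4,5} \<or> \<sigma> \<in> Pow {2,5,6}"
    unfolding Delta_def C0_def mem_Collect_eq bex_simps Pow_iff by (elim disjE) blast+
  with \<open>\<sigma> \<notin> C0\<close> show ?thesis
    unfolding C0_def Pow_insert Pow_empty image_insert image_empty Un_insert_left Un_insert_right
      Un_empty_left Un_empty_right insert_iff empty_iff
    by argo
qed

lemma links_of_vertices_C0:
  "link (Delta C0) {4} = Pow {3,5,6} \<union> Pow {1,5}"
  "link (Delta C0) {5} = Pow {3,4,6} \<union> Pow {1,4} \<union> Pow {2,6}"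
  "link (Delta C0) {6} = Pow {3,4,5} \<union> Pow {2,5}"
proof -
  \<comment> \<open>The surplus simplices come from the non-maximal codewords 45 and 56 and are
    absorbed by the others.\<close>
  have "link (Delta C0) {4} = Pow {3,5,6} \<union> (Pow {1,5} \<union> Pow {5})"
    "link (Delta C0) {5} = Pow {3,4,6} \<union> (Pow {1,4} \<union> (Pow {2,6} \<union> (Pow {4} \<union> Pow {6})))"
    "link (Delta C0) {6} = Pow {3,4,5} \<union> (Pow {2,5} \<union> Pow {5})"
    by (simp_all add: link_Delta C0_def insert_Diff_if)
  moreover have "Pow {5} \<subseteq> Pow {1,5::nat}" "Pow {5} \<subseteq> Pow {2,5::nat}"
    "Pow {4} \<subseteq> Pow {1,4::nat}" "Pow {6} \<subseteq> Pow {2,6::nat}"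
    by (rule Pow_mono, simp)+
  moreover have "A \<union> (B \<union> C) = A \<union> B" if "C \<subseteq> B" for A B C :: "nat set set"
    using that by blast
  moreover have "A \<union> (B \<union> (C \<union> (D \<union> E))) = A \<union> B \<union> C" if "D \<subseteq> B" "E \<subseteq> C" for A B C D E :: "nat set set"
    using that by blast
  ultimately show "link (Delta C0) {4} = Pow {3,5,6} \<union> Pow {1,5}"
    "link (Delta C0) {5} = Pow {3,4,6} \<union> Pow {1,4} \<union> Pow {2,6}"
    "link (Delta C0) {6} = Pow {3,4,5} \<union> Pow {2,5}"
    by presburger+
qed

text \<open>Each of these faces lies in exactly one codeword, so its link is a full simplex.\<close>

lemma links_of_edges_and_triangles_C0:
  "link (Delta C0) {3,4} = Pow {5,6}"
  "link (Delta C0) {3,5} = Pow {4,6}"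
  "link (Delta C0) {3,6} = Pow {4,5}"
  "link (Delta C0) {4,6} = Pow {3,5}"
  "link (Delta C0) {1,2} = Pow {3}"
  "link (Delta C0) {1,3} = Pow {2}"
  "link (Delta C0) {2,3} = Pow {1}"
  "link (Delta C0) {1,4} = Pow {5}"
  "link (Delta C0) {1,5} = Pow {4}"
  "link (Delta C0) {2,5} = Pow {6}"
  "link (Delta C0) {2,6} = Pow {5}"
  "link (Delta C0) {3,4,5} = Pow {6}"
  "link (Delta C0) {3,4,6} = Pow {5}"
  "link (Delta C0) {3,5,6} = Pow {4}"
  "link (Delta C0) {4,5,6} = Pow {3}"
  by (simp_all add: link_Delta C0_def insert_Diff_if)

text \<open>For the identity vertex map, contiguity to the constant map says exactly that the
  complex is a cone with apex \<open>v\<close>.\<close>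

lemma complex_contractible_cone:
  assumes "finite V" "\<And>\<tau>. \<tau> \<in> K \<Longrightarrow> \<tau> \<subseteq> V" "{v} \<in> K" "\<And>\<tau>. \<tau> \<in> K \<Longrightarrow> insert v \<tau> \<in> K"
  shows "complex_contractible K"
  by (rule contractible_if_contiguous[of V K v id]) (use assms in auto)

lemma complex_contractible_Pow:
  assumes "finite V" "V \<noteq> {}"
  shows "complex_contractible (Pow V)"
proof -
  obtain v where "v \<in> V" using assms(2) by blast
  then show ?thesis using assms(1) by (intro complex_contractible_cone[of V _ v]) auto
qed

lemma collapsible_Pow_singleton: "collapsible (Pow {v})"
proof -
  have "Pow {v} = {{}, {v}}" by blast
  then show ?thesis using collapsible_point[of v] by simp
qed

lemma collapsible_Pow_pair:
  assumes "a \<noteq> b"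
  shows "collapsible (Pow {a, b})"
proof -
  have "Pow {a, b} = insert {a} (insert (insert b {a}) {{}, {b}})"
    by (auto simp: Pow_insert)
  then show ?thesis using collapsible_insert[OF collapsible_point, of "{a}" b b] assms by simp
qed

lemma contractible_links_C0:
  "complex_contractible (Pow {3,5,6} \<union> Pow {1,5})"
  "complex_contractible (Pow {3,4,6} \<union> Pow {1,4} \<union> Pow {2,6})"
  "complex_contractible (Pow {3,4,5} \<union> Pow {2,5})"
proof -
  show "complex_contractible (Pow {3,5,6} \<union> Pow {1,5})"
    by (rule complex_contractible_cone[of "{1,3,5,6}" _ 5]) auto
  show "complex_contractible (Pow {3,4,5} \<union> Pow {2,5})"
    by (rule complex_contractible_cone[of "{2,3,4,5}" _ 5]) auto
  \<comment> \<open>Folds the two attached edges onto the triangle 346 by sending their free ends 1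
    and 2 to 4 and 6; the triangle is then a cone with apex 4. The other two links are cones with
    apex 5.\<close>
  define \<rho> where "\<rho> = (\<lambda>i::nat. if i = 1 then 4 else if i = 2 then 6 else i)"
  show "complex_contractible (Pow {3,4,6} \<union> Pow {1,4} \<union> Pow {2,6})"
  proof (rule contractible_if_contiguous[of "{1,2,3,4,6}" _ 4 \<rho>])
    have \<rho>: "\<rho> ` {3,4,6} = {3,4,6}" "\<rho> ` {1,4} = {4}" "\<rho> ` {2,6} = {6}"
      by (auto simp: \<rho>_def)
    fix \<tau> :: "nat set" assume \<tau>: "\<tau> \<in> Pow {3,4,6} \<union> Pow {1,4} \<union> Pow {2,6}"
    then have im: "\<tau> \<subseteq> {3,4,6} \<and> \<rho> ` \<tau> \<subseteq> {3,4,6} \<or> \<tau> \<subseteq> {1,4} \<and> \<rho> ` \<tau> \<subseteq> {4} \<or> \<tau> \<subseteq> {2,6} \<and> \<rho> ` \<tau> \<subseteq> {6}"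
      using \<rho> image_mono[of \<tau> _ \<rho>] by (metis Pow_iff Un_iff)
    show "\<tau> \<subseteq> {1,2,3,4,6}" using \<tau> by auto
    show "\<tau> \<union> \<rho> ` \<tau> \<in> Pow {3,4,6} \<union> Pow {1,4} \<union> Pow {2,6}" using im by blast
    show "insert 4 (\<rho> ` \<tau>) \<in> Pow {3,4,6} \<union> Pow {1,4} \<union> Pow {2,6}" using im by blast
  qed auto
qed

text \<open>The edge hangs on \<open>K\<close> at \<open>b\<close>, and its other end
  \<open>{a}\<close> is a free face.\<close>

lemma collapsible_Un_edge:
  assumes "collapsible K" "\<And>\<tau>. \<tau> \<in> K \<Longrightarrow> a \<notin> \<tau>" "{b} \<in> K" "{} \<in> K" "a \<noteq> b"
  shows "collapsible (K \<union> Pow {a, b})"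
proof -
  have "K \<union> Pow {a, b} = insert {a} (insert (insert b {a}) K)"
    using assms(3,4) unfolding Pow_insert by (simp add: insert_absorb insert_commute)
  then show ?thesis using assms collapsible_insert[of K "{a}" b] by force
qed

text \<open>First \<open>{a, b}\<close> is removed with the whole triangle, then \<open>{a}\<close>
  with \<open>{a, c}\<close>; the edge \<open>{b, c}\<close> remains.\<close>

lemma collapsible_Pow_triple:
  assumes "a \<noteq> b" "a \<noteq> c" "b \<noteq> c"
  shows "collapsible (Pow {a, b, c})"
proof -
  let ?K = "insert {a} (insert (insert c {a}) (Pow {b, c}))"
  have a: "a \<notin> {b, c}" and b: "b \<notin> {c, a}" "b \<notin> {a}" and c: "c \<notin> {a}" "c \<notin> {a, b}"
    using assms by simp_all
  have "\<forall>\<rho>\<in>Pow {b, c}. \<not> {a} \<subseteq> \<rho>" using a by blast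
  then have "collapsible ?K"
    by (intro collapsible_insert collapsible_Pow_pair assms(3) c finite.intros insert_not_empty)
  moreover have "\<forall>\<rho>\<in>?K. \<not> {a, b} \<subseteq> \<rho>"
  proof
    fix \<rho> assume "\<rho> \<in> ?K"
    then have "\<rho> \<subseteq> {b, c} \<or> \<rho> \<subseteq> {c, a}" by blast
    with a b show "\<not> {a, b} \<subseteq> \<rho>" by (meson insert_subset subset_iff)
  qed
  ultimately have "collapsible (insert {a, b} (insert (insert c {a, b}) ?K))"
    using c(2) by (intro collapsible_insert[of ?K "{a, b}" c]) simp_all
  also have "insert {a, b} (insert (insert c {a, b}) ?K) = Pow {a, b, c}"
    (is "?L = ?R")
  proof
    show "?L \<subseteq> ?R" by blast
    have "X \<in> ?L" if "X \<subseteq> {a,b,c}" for X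
    proof (cases "a \<in> X")
      case True
      then have "X = {a} \<union> (X \<inter> {b}) \<union> (X \<inter> {c})" using that by blast
      then show ?thesis by (cases "b \<in> X"; cases "c \<in> X"; simp add: insert_commute; fail)
    next
      case False then show ?thesis using that by blast
    qed
    then show "?R \<subseteq> ?L" by blast
  qed
  finally show ?thesis .
qed

lemma collapsible_links_C0:
  "collapsible (Pow {3,5,6} \<union> Pow {1,5})"
  "collapsible (Pow {3,4,6} \<union> Pow {1,4} \<union> Pow {2,6})"
  "collapsible (Pow {3,4,5} \<union> Pow {2,5})"
proof -
  show "collapsible (Pow {3,5,6} \<union> Pow {1,5})"
    by (rule collapsible_Un_edge[OF collapsible_Pow_triple]) auto
  show "collapsible (Pow {3,4,6} \<union> Pow {1,4} \<union> Pow {2,6})"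
    by (rule collapsible_Un_edge[OF collapsible_Un_edge[OF collapsible_Pow_triple]]) auto
  show "collapsible (Pow {3,4,5} \<union> Pow {2,5})"
    by (rule collapsible_Un_edge[OF collapsible_Pow_triple]) auto
qed

lemma links_of_missing_faces_C0:
  assumes "\<sigma> \<in> Delta C0 - C0"
  shows "complex_contractible (link (Delta C0) \<sigma>)" "collapsible (link (Delta C0) \<sigma>)"
proof -
  have "complex_contractible (link (Delta C0) \<sigma>) \<and> collapsible (link (Delta C0) \<sigma>)"
    using missing_faces_C0[OF assms] unfolding insert_iff empty_iff
    by (elim disjE)
      (simp_all only: links_of_vertices_C0 links_of_edges_and_triangles_C0 simp_thms contractible_links_C0 collapsible_links_C0
        complex_contractible_Pow collapsible_Pow_singleton collapsible_Pow_pair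
        finite.intros insert_not_empty num.inject num.distinct numeral_eq_iff)
  then show "complex_contractible (link (Delta C0) \<sigma>)" "collapsible (link (Delta C0) \<sigma>)" by auto
qed

section \<open>Partial realizations\<close>

definition open_convex :: "nat \<Rightarrow> (nat \<Rightarrow> real) set \<Rightarrow> bool" where
  "open_convex d S \<longleftrightarrow> openin (Euclidean_space d) S \<and> convex_pts S"

text \<open>A realization seen as a labelling: the sets where the label contains \<open>j\<close>
  realize the code of all labels.\<close>

lemma convex_code_image:
  assumes X: "open_convex d X" and U: "\<And>j. j \<in> {1..n} \<Longrightarrow> open_convex d {x \<in> X. j \<in> h x}"
    and h: "\<And>x. x \<in> X \<Longrightarrow> h x \<subseteq> {1..n}"
  shows "convex_code (h ` X)"
proof -
  let ?U = "\<lambda>j. {x \<in> X. j \<in> h x}"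
  have word: "h x = {j \<in> {1..n}. x \<in> ?U j}" if "x \<in> X" for x
    using h[OF that] that by blast
  have "h ` X = code_of n ?U X"
  proof (rule set_eqI)
    fix \<sigma>
    have "\<sigma> \<in> h ` X \<longleftrightarrow> (\<exists>x\<in>X. \<sigma> = h x)" by (simp only: image_iff)
    also have "\<dots> \<longleftrightarrow> (\<exists>x\<in>X. \<sigma> = {j \<in> {1..n}. x \<in> ?U j})"
      by (intro bex_cong refl arg_cong[of _ _ "(=) \<sigma>"] word)
    also have "\<dots> \<longleftrightarrow> \<sigma> \<in> code_of n ?U X" by (rule code_of_iff[symmetric])
    finally show "\<sigma> \<in> h ` X \<longleftrightarrow> \<sigma> \<in> code_of n ?U X" .
  qed
  moreover have "\<forall>i\<in>{1..n}. openin (Euclidean_space d) (?U i) \<and> convex_pts (?U i) \<and> ?U i \<subseteq> X"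
  proof
    fix i assume "i \<in> {1..n}"
    from U[OF this] show "openin (Euclidean_space d) (?U i) \<and> convex_pts (?U i) \<and> ?U i \<subseteq> X"
      unfolding open_convex_def by blast
  qed
  ultimately show ?thesis
    unfolding convex_code_def using X[unfolded open_convex_def]
    by (intro exI[of _ n] exI[of _ d] exI[of _ X] exI[of _ ?U] conjI) simp_all
qed

text \<open>Controlling all trunks but \<open>R\<close>, and not just the sets of single neurons,
  lets the labelling be composed with any morphism none of whose coordinates is \<open>R\<close>.
  The labels need not exhaust \<open>C\<close>.\<close>

definition partial_realization ::
  "nat set set \<Rightarrow> nat set set \<Rightarrow> (nat \<Rightarrow> real) set \<Rightarrow> ((nat \<Rightarrow> real) \<Rightarrow> nat set) \<Rightarrow> bool" where
  "partial_realization C R X \<kappa> \<longleftrightarrow> (\<exists>d. open_convex d X \<and> \<kappa> ` X \<subseteq> C \<and>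
     (\<forall>T. trunk C T \<longrightarrow> T \<noteq> R \<longrightarrow> open_convex d {x \<in> X. \<kappa> x \<in> T}))"

lemma trunk_Tk: "finite \<sigma> \<Longrightarrow> trunk C (Tk C \<sigma>)"
  by (auto simp: trunk_def)

lemma trunk_Int:
  assumes "trunk C S" "trunk C T"
  shows "trunk C (S \<inter> T)"
proof (cases "S = {} \<or> T = {}")
  case False
  then obtain \<sigma> \<tau> where "finite \<sigma>" "finite \<tau>" "S = Tk C \<sigma>" "T = Tk C \<tau>"
    using assms by (auto simp: trunk_def)
  then have "S \<inter> T = Tk C (\<sigma> \<union> \<tau>)" "finite (\<sigma> \<union> \<tau>)" by (auto simp: Tk_def)
  then show ?thesis using trunk_Tk by metis
qed (auto simp: trunk_def)

text \<open>This set is the preimage of the simple trunk of \<open>j\<close>. A morphism is thus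
  encoded by one trunk of its source for each neuron of its target.\<close>

lemma trunk_of_coordinate:
  assumes "code_morphism C D f"
  shows "trunk C {c \<in> C. j \<in> f c}"
proof -
  have "trunk C {c \<in> C. f c \<in> Tk D {j}}"
    using assms trunk_Tk[of "{j}" D] by (simp add: code_morphism_def)
  moreover have "{c \<in> C. f c \<in> Tk D {j}} = {c \<in> C. j \<in> f c}"
    using assms by (auto simp: code_morphism_def Tk_def)
  ultimately show ?thesis by simp
qed

text \<open>Compose the labelling with \<open>f\<close>: each coordinate of \<open>f\<close> is a
  trunk other than \<open>R\<close>. A codeword need not be a label itself; a label that agrees with
  it on all trunks other than \<open>R\<close> has the same image.\<close>

lemma convex_image_if_partial_realization:
  assumes r: "partial_realization C R X \<kappa>" and f: "code_morphism C D f" "is_code D"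
    and R: "\<And>j. {c \<in> C. j \<in> f c} \<noteq> R"
    and cover: "\<And>c. c \<in> C \<Longrightarrow> \<exists>x\<in>X. \<forall>T. trunk C T \<longrightarrow> T \<noteq> R \<longrightarrow> (\<kappa> x \<in> T \<longleftrightarrow> c \<in> T)"
  shows "convex_code (f ` C)"
proof -
  obtain d where X: "open_convex d X" and \<kappa>: "\<kappa> ` X \<subseteq> C"
    and pre: "\<And>T. trunk C T \<Longrightarrow> T \<noteq> R \<Longrightarrow> open_convex d {x \<in> X. \<kappa> x \<in> T}"
    using r unfolding partial_realization_def by blast
  obtain n where n: "D \<subseteq> Pow {1..n}" using f(2) by (auto simp: is_code_def)
  have "convex_code ((\<lambda>x. f (\<kappa> x)) ` X)"
  proof (rule convex_code_image[OF X])
    fix j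
    have "{x \<in> X. j \<in> f (\<kappa> x)} = {x \<in> X. \<kappa> x \<in> {c \<in> C. j \<in> f c}}" using \<kappa> by blast
    then show "open_convex d {x \<in> X. j \<in> f (\<kappa> x)}"
      using pre[OF trunk_of_coordinate[OF f(1)] R] by simp
  next
    fix x assume "x \<in> X"
    then have "f (\<kappa> x) \<in> D" using \<kappa> f(1) unfolding code_morphism_def by blast
    then show "f (\<kappa> x) \<subseteq> {1..n}" using n by blast
  qed
  moreover have "(\<lambda>x. f (\<kappa> x)) ` X = f ` C"
  proof (intro equalityI subsetI)
    fix w assume "w \<in> f ` C"
    then obtain c where c: "c \<in> C" "w = f c" by blast
    obtain x where x: "x \<in> X" "\<And>T. trunk C T \<Longrightarrow> T \<noteq> R \<Longrightarrow> (\<kappa> x \<in> T \<longleftrightarrow> c \<in> T)"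
      using cover[OF c(1)] by blast
    have "f (\<kappa> x) = f c"
    proof (rule set_eqI)
      fix j
      have "\<kappa> x \<in> C" using \<kappa> x(1) by blast
      then show "j \<in> f (\<kappa> x) \<longleftrightarrow> j \<in> f c"
        using x(2)[OF trunk_of_coordinate[OF f(1), of j] R] c(1) by blast
    qed
    then show "w \<in> (\<lambda>x. f (\<kappa> x)) ` X" using x(1) c(2) by (metis image_eqI)
  qed (use \<kappa> in blast)
  ultimately show ?thesis by simp
qed

lemma convex_trunk_if_partial_realization:
  assumes r: "partial_realization C R X \<kappa>" and C: "is_code C"
    and T: "trunk C T" "\<not> R \<subseteq> T" "T \<subseteq> \<kappa> ` X"
  shows "convex_code T"
proof -
  obtain d where X: "open_convex d X" and \<kappa>: "\<kappa> ` X \<subseteq> C"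
    and pre: "\<And>T. trunk C T \<Longrightarrow> T \<noteq> R \<Longrightarrow> open_convex d {x \<in> X. \<kappa> x \<in> T}"
    using r unfolding partial_realization_def by blast
  obtain n where n: "C \<subseteq> Pow {1..n}" using C by (auto simp: is_code_def)
  let ?Y = "{x \<in> X. \<kappa> x \<in> T}"
  have "convex_code (\<kappa> ` ?Y)"
  proof (rule convex_code_image)
    show "open_convex d ?Y" using pre T by blast
    fix j
    have "{x \<in> ?Y. j \<in> \<kappa> x} = {x \<in> X. \<kappa> x \<in> T \<inter> Tk C {j}}"
      using \<kappa> by (auto simp: Tk_def)
    \<comment> \<open>A subset of \<open>T\<close> cannot be \<open>R\<close>, which is not
      contained in \<open>T\<close>.\<close>
    moreover have "T \<inter> Tk C {j} \<noteq> R" using T(2) by blast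
    ultimately show "open_convex d {x \<in> ?Y. j \<in> \<kappa> x}"
      using pre[OF trunk_Int[OF T(1) trunk_Tk[of "{j}"]]] by simp
  next
    fix x assume "x \<in> ?Y"
    then show "\<kappa> x \<subseteq> {1..n}" using \<kappa> n by blast
  qed
  moreover have "\<kappa> ` ?Y = T" using T(3) by blast
  ultimately show ?thesis by simp
qed

lemma code_isomorphic_image:
  assumes f: "code_morphism C D f" and I: "finite I" "C \<subseteq> Pow I"
    and gen: "\<And>r. r \<in> I \<Longrightarrow> \<exists>j. {c \<in> C. j \<in> f c} = Tk C {r}"
  shows "code_isomorphic C (f ` C)"
proof -
  obtain J where J: "\<And>r. r \<in> I \<Longrightarrow> {c \<in> C. J r \<in> f c} = Tk C {r}"
    using gen by metis
  have J': "J r \<in> f c \<longleftrightarrow> r \<in> c" if "r \<in> I" "c \<in> C" for r c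
    using J[OF that(1)] that(2) by (auto simp: Tk_def set_eq_iff)
  have "inj_on f C"
  proof (rule inj_onI)
    fix a b assume ab: "a \<in> C" "b \<in> C" "f a = f b"
    then have "r \<in> a \<longleftrightarrow> r \<in> b" if "r \<in> I" for r using J' that by metis
    then show "a = b" using ab I(2) by blast
  qed
  let ?g = "the_inv_into C f"
  have g: "?g (f c) = c" if "c \<in> C" for c
    using that \<open>inj_on f C\<close> by (rule the_inv_into_f_f[rotated])
  have "code_morphism C (f ` C) f"
    unfolding code_morphism_def
  proof (intro conjI allI impI)
    fix T assume "trunk (f ` C) T"
    then consider "T = {}" | \<sigma> where "finite \<sigma>" "T = Tk (f ` C) \<sigma>" by (auto simp: trunk_def)
    then show "trunk C {c \<in> C. f c \<in> T}"
    proof cases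
      case 2
      then have "{c \<in> C. f c \<in> T} = {c \<in> C. f c \<in> Tk D \<sigma>}"
        using f by (auto simp: Tk_def code_morphism_def)
      then show ?thesis using f 2 trunk_Tk[of \<sigma> D] by (auto simp: code_morphism_def)
    qed (auto simp: trunk_def)
  qed simp
  moreover have "code_morphism (f ` C) C ?g"
    unfolding code_morphism_def
  proof (intro conjI allI impI)
    show "?g ` f ` C \<subseteq> C" using g by auto
    fix T assume "trunk C T"
    \<comment> \<open>If \<open>\<sigma>\<close> is not inside \<open>I\<close>, no codeword
      contains it and the trunk is empty.\<close>
    then consider "T = {}" | \<sigma> where "finite \<sigma>" "T = Tk C \<sigma>" "\<sigma> \<subseteq> I" 
      using I(2) by (fastforce simp: trunk_def Tk_def)
    then show "trunk (f ` C) {c \<in> f ` C. ?g c \<in> T}"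
    proof cases
      case 2
      have "?g (f c) \<in> T \<longleftrightarrow> J ` \<sigma> \<subseteq> f c" if "c \<in> C" for c
      proof -
        have "?g (f c) \<in> T \<longleftrightarrow> \<sigma> \<subseteq> c" using 2(2) g[OF that] that by (simp add: Tk_def)
        also have "\<dots> \<longleftrightarrow> (\<forall>r\<in>\<sigma>. J r \<in> f c)" using 2(3) J'[OF _ that] by blast
        finally show ?thesis by blast
      qed
      then have "{c \<in> f ` C. ?g c \<in> T} = Tk (f ` C) (J ` \<sigma>)"
        unfolding Tk_def by blast
      then show ?thesis using 2 trunk_Tk[of "J ` \<sigma>" "f ` C"] by simp
    qed (auto simp: trunk_def)
  qed
  ultimately show ?thesis
    unfolding code_isomorphic_def using g by (intro exI[of _ f] exI[of _ ?g]) auto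
qed

section \<open>Open convex polyhedral regions in three-space\<close>

lemma open_convex_Int:
  "open_convex d A \<Longrightarrow> open_convex d B \<Longrightarrow> open_convex d (A \<inter> B)"
  by (auto simp: open_convex_def convex_pts_def)

lemma open_convex_empty: "open_convex d {}"
  by (simp add: open_convex_def convex_pts_def)

text \<open>Sets given by predicates on the coordinates let openness and convexity be derived from
  the shape of the formula, a conjunction of strict linear inequalities.\<close>

definition region :: "(real \<Rightarrow> real \<Rightarrow> real \<Rightarrow> bool) \<Rightarrow> (nat \<Rightarrow> real) set" where
  "region P = {p \<in> topspace (Euclidean_space 3). P (p 0) (p 1) (p 2)}"

lemma open_convex_region_halfspace:
  assumes "\<And>x y z. P x y z \<longleftrightarrow> a * x + b * y + c * z < k"
  shows "open_convex 3 (region P)"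
proof -
  let ?l = "\<lambda>p :: nat \<Rightarrow> real. a * p 0 + b * p 1 + c * p 2"
  have "continuous_map (Euclidean_space 3) euclideanreal (\<lambda>p. p i)" for i
    unfolding Euclidean_space_def
    by (intro continuous_map_from_subtopology continuous_map_product_projection) simp
  then have "continuous_map (Euclidean_space 3) euclideanreal ?l"
    by (intro continuous_intros)
  then have "openin (Euclidean_space 3) {p \<in> topspace (Euclidean_space 3). ?l p \<in> {..<k}}"
    by (rule openin_continuous_map_preimage) simp
  then have "openin (Euclidean_space 3) (region P)" by (simp add: region_def assms)
  moreover have "convex_pts (region P)"
    unfolding convex_pts_def
  proof (intro ballI allI impI)
    fix p q and t :: real assume p: "p \<in> region P" and q: "q \<in> region P" and t: "0 \<le> t \<and> t \<le> 1"
    have "(1 - t) * ?l p + t * ?l q < k"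
      using convex_bound_lt[of "?l p" k "?l q" "1 - t" t] p q t by (simp add: region_def assms)
    then have "?l (\<lambda>i. (1 - t) * p i + t * q i) < k" by (simp add: algebra_simps)
    then show "(\<lambda>i. (1 - t) * p i + t * q i) \<in> region P"
      using p q by (simp add: region_def assms topspace_Euclidean_space)
  qed
  ultimately show ?thesis by (simp add: open_convex_def)
qed

lemma open_convex_region_conj:
  assumes "open_convex 3 (region P)" "open_convex 3 (region Q)"
  shows "open_convex 3 (region (\<lambda>x y z. P x y z \<and> Q x y z))"
proof -
  have "region (\<lambda>x y z. P x y z \<and> Q x y z) = region P \<inter> region Q" by (auto simp: region_def)
  then show ?thesis using open_convex_Int[OF assms] by simp
qed

lemma open_convex_region_atoms:
  "open_convex 3 (region (\<lambda>x y z. x < k))" "open_convex 3 (region (\<lambda>x y z. k < x))"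
  "open_convex 3 (region (\<lambda>x y z. y < k))" "open_convex 3 (region (\<lambda>x y z. k < y))"
  "open_convex 3 (region (\<lambda>x y z. z < k))" "open_convex 3 (region (\<lambda>x y z. k < z))"
  "open_convex 3 (region (\<lambda>x y z. k < x + y))" "open_convex 3 (region (\<lambda>x y z. k < x + y + z))"
         apply (rule open_convex_region_halfspace[of _ 1 0 0 k], simp)
        apply (rule open_convex_region_halfspace[of _ "-1" 0 0 "-k"], simp)
       apply (rule open_convex_region_halfspace[of _ 0 1 0 k], simp)
      apply (rule open_convex_region_halfspace[of _ 0 "-1" 0 "-k"], simp)
     apply (rule open_convex_region_halfspace[of _ 0 0 1 k], simp)
    apply (rule open_convex_region_halfspace[of _ 0 0 "-1" "-k"], simp)
   apply (rule open_convex_region_halfspace[of _ "-1" "-1" 0 "-k"], auto)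
  apply (rule open_convex_region_halfspace[of _ "-1" "-1" "-1" "-k"], auto)
  done

lemmas open_convex_region_intros = open_convex_region_conj open_convex_region_atoms

definition word_at :: "(real \<Rightarrow> real \<Rightarrow> real \<Rightarrow> nat set) \<Rightarrow> (nat \<Rightarrow> real) \<Rightarrow> nat set" where
  "word_at k p = k (p 0) (p 1) (p 2)"

lemma region_point:
  assumes "P x y z"
  shows "k x y z \<in> word_at k ` region P"
proof
  let ?p = "\<lambda>i. if i = 0 then x else if i = 1 then y else if i = 2 then z else 0 :: real"
  show "k x y z = word_at k ?p" by (simp add: word_at_def)
  show "?p \<in> region P" using assms by (auto simp: region_def topspace_Euclidean_space)
qed

section \<open>The trunks of \<open>C0\<close>\<close>

lemma Tk_insert: "Tk (insert c C) \<sigma> = (if \<sigma> \<subseteq> c then insert c (Tk C \<sigma>) else Tk C \<sigma>)"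
  by (auto simp: Tk_def)

lemma Tk_empty: "Tk {} \<sigma> = {}"
  by (simp add: Tk_def)

lemma Tk_C0:
  "Tk C0 {1} = {{1,2,3}, {1,4,5}, {1}}"
  "Tk C0 {2} = {{1,2,3}, {2,5,6}, {2}}"
  "Tk C0 {3} = {{3,4,5,6}, {1,2,3}, {3}}"
  "Tk C0 {4} = {{3,4,5,6}, {1,4,5}, {4,5}}"
  "Tk C0 {5} = {{3,4,5,6}, {1,4,5}, {2,5,6}, {4,5}, {5,6}}"
  "Tk C0 {6} = {{3,4,5,6}, {2,5,6}, {5,6}}"
  by (simp_all add: C0_def Tk_insert Tk_empty)

text \<open>Neurons 4 and 6 each imply 5, so 45 and 56 give the trunks of 4 and 6. Every other face
  with at least two vertices lies in a single codeword, which is maximal.\<close>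

lemma trunk_C0_cases:
  assumes "trunk C0 T"
  shows "T \<in> {{}, C0, Tk C0 {1}, Tk C0 {2}, Tk C0 {3}, Tk C0 {4}, Tk C0 {5}, Tk C0 {6},
    {{1,2,3}}, {{1,4,5}}, {{2,5,6}}, {{3,4,5,6}}}"
proof (cases "T = {}")
  case False
  then obtain \<sigma> where \<sigma>: "T = Tk C0 \<sigma>" using assms by (auto simp: trunk_def)
  then obtain c where "c \<in> C0" "\<sigma> \<subseteq> c" using False by (auto simp: Tk_def)
  then have "\<sigma> \<in> Pow {3,4,5,6} \<or> \<sigma> \<in> Pow {1,2,3} \<or> \<sigma> \<in> Pow {1,4,5} \<or> \<sigma> \<in> Pow {2,5,6}"
    unfolding C0_def insert_iff empty_iff by (elim disjE) (simp_all, blast+)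
  then consider "\<sigma> = {}" | "\<sigma> = {1}" | "\<sigma> = {2}" | "\<sigma> = {3}" | "\<sigma> = {4} \<or> \<sigma> = {4,5}"
    | "\<sigma> = {5}" | "\<sigma> = {6} \<or> \<sigma> = {5,6}"
    | "\<sigma> = {1,2} \<or> \<sigma> = {1,3} \<or> \<sigma> = {2,3} \<or> \<sigma> = {1,2,3}"
    | "\<sigma> = {1,4} \<or> \<sigma> = {1,5} \<or> \<sigma> = {1,4,5}"
    | "\<sigma> = {2,5} \<or> \<sigma> = {2,6} \<or> \<sigma> = {2,5,6}"
    | "\<sigma> = {3,4} \<or> \<sigma> = {3,5} \<or> \<sigma> = {3,6} \<or> \<sigma> = {4,6} \<or> \<sigma> = {3,4,5} \<or> \<sigma> = {3,4,6}
       \<or> \<sigma> = {3,5,6} \<or> \<sigma> = {4,5,6} \<or> \<sigma> = {3,4,5,6}"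
    unfolding Pow_insert Pow_empty image_insert image_empty Un_insert_left Un_insert_right
      Un_empty_left Un_empty_right insert_iff empty_iff
    by argo
  then show ?thesis
  proof cases
    case 1
    then have "T = C0" using \<sigma> by (simp add: Tk_def)
    then show ?thesis by (simp only: insert_iff simp_thms)
  next
    case 5
    then have "T = Tk C0 {4}" using \<sigma> by (elim disjE) (simp_all add: C0_def Tk_insert Tk_empty)
    then show ?thesis by (simp only: insert_iff simp_thms)
  next
    case 7
    then have "T = Tk C0 {6}" using \<sigma> by (elim disjE) (simp_all add: C0_def Tk_insert Tk_empty)
    then show ?thesis by (simp only: insert_iff simp_thms)
  next
    case 8
    then have "T = {{1,2,3}}" using \<sigma> by (elim disjE) (simp_all add: C0_def Tk_insert Tk_empty)
    then show ?thesis by (simp only: insert_iff simp_thms)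
  next
    case 9
    then have "T = {{1,4,5}}" using \<sigma> by (elim disjE) (simp_all add: C0_def Tk_insert Tk_empty)
    then show ?thesis by (simp only: insert_iff simp_thms)
  next
    case 10
    then have "T = {{2,5,6}}" using \<sigma> by (elim disjE) (simp_all add: C0_def Tk_insert Tk_empty)
    then show ?thesis by (simp only: insert_iff simp_thms)
  next
    case 11
    then have "T = {{3,4,5,6}}" using \<sigma> by (elim disjE) (simp_all add: C0_def Tk_insert Tk_empty)
    then show ?thesis by (simp only: insert_iff simp_thms)
  next
    case 2
    then show ?thesis by (simp only: \<sigma> insert_iff simp_thms)
  next
    case 3
    then show ?thesis by (simp only: \<sigma> insert_iff simp_thms)
  next
    case 4
    then show ?thesis by (simp only: \<sigma> insert_iff simp_thms)
  next
    case 6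
    then show ?thesis by (simp only: \<sigma> insert_iff simp_thms)
  qed
next
  case True
  then show ?thesis by simp
qed

text \<open>Several pairs of neurons cut out the same maximal codeword, so that a pair avoiding a
  given neuron \<open>r\<close> can be chosen where one exists.\<close>

lemma C0_word_iff:
  assumes "w \<in> C0"
  shows "w = {1,2,3} \<longleftrightarrow> 2 \<in> w \<and> 3 \<in> w" "w = {1,2,3} \<longleftrightarrow> 1 \<in> w \<and> 2 \<in> w"
    "w = {1,2,3} \<longleftrightarrow> 1 \<in> w \<and> 3 \<in> w"
    "w = {1,4,5} \<longleftrightarrow> 1 \<in> w \<and> 4 \<in> w" "w = {1,4,5} \<longleftrightarrow> 1 \<in> w \<and> 5 \<in> w"
    "w = {2,5,6} \<longleftrightarrow> 2 \<in> w \<and> 6 \<in> w" "w = {2,5,6} \<longleftrightarrow> 2 \<in> w \<and> 5 \<in> w"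
    "w = {3,4,5,6} \<longleftrightarrow> 4 \<in> w \<and> 6 \<in> w" "w = {3,4,5,6} \<longleftrightarrow> 3 \<in> w \<and> 4 \<in> w"
    "w = {3,4,5,6} \<longleftrightarrow> 3 \<in> w \<and> 6 \<in> w"
proof -
  have "\<forall>w\<in>C0. (1 \<in> w \<and> 3 \<in> w \<longrightarrow> w = {1,2,3}) \<and> (2 \<in> w \<and> 3 \<in> w \<longrightarrow> w = {1,2,3}) \<and> (1 \<in> w \<and> 2 \<in> w \<longrightarrow> w = {1,2,3})
    \<and> (1 \<in> w \<and> 4 \<in> w \<longrightarrow> w = {1,4,5}) \<and> (1 \<in> w \<and> 5 \<in> w \<longrightarrow> w = {1,4,5})
    \<and> (2 \<in> w \<and> 6 \<in> w \<longrightarrow> w = {2,5,6}) \<and> (2 \<in> w \<and> 5 \<in> w \<longrightarrow> w = {2,5,6})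
    \<and> (4 \<in> w \<and> 6 \<in> w \<longrightarrow> w = {3,4,5,6}) \<and> (3 \<in> w \<and> 4 \<in> w \<longrightarrow> w = {3,4,5,6})
    \<and> (3 \<in> w \<and> 6 \<in> w \<longrightarrow> w = {3,4,5,6})"
    by (simp add: C0_def)
  note * = bspec[OF this assms]
  show "w = {1,2,3} \<longleftrightarrow> 2 \<in> w \<and> 3 \<in> w" using * by (intro iffI) (simp, argo)
  show "w = {1,2,3} \<longleftrightarrow> 1 \<in> w \<and> 2 \<in> w" using * by (intro iffI) (simp, argo)
  show "w = {1,2,3} \<longleftrightarrow> 1 \<in> w \<and> 3 \<in> w" using * by (intro iffI) (simp, argo)
  show "w = {1,4,5} \<longleftrightarrow> 1 \<in> w \<and> 4 \<in> w" using * by (intro iffI) (simp, argo)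
  show "w = {1,4,5} \<longleftrightarrow> 1 \<in> w \<and> 5 \<in> w" using * by (intro iffI) (simp, argo)
  show "w = {2,5,6} \<longleftrightarrow> 2 \<in> w \<and> 6 \<in> w" using * by (intro iffI) (simp, argo)
  show "w = {2,5,6} \<longleftrightarrow> 2 \<in> w \<and> 5 \<in> w" using * by (intro iffI) (simp, argo)
  show "w = {3,4,5,6} \<longleftrightarrow> 4 \<in> w \<and> 6 \<in> w" using * by (intro iffI) (simp, argo)
  show "w = {3,4,5,6} \<longleftrightarrow> 3 \<in> w \<and> 4 \<in> w" using * by (intro iffI) (simp, argo)
  show "w = {3,4,5,6} \<longleftrightarrow> 3 \<in> w \<and> 6 \<in> w" using * by (intro iffI) (simp, argo)
qed

text \<open>Trunks of single codewords are intersections of two simple trunks other than that of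
  \<open>r\<close>. The exceptions are 145 for \<open>r = 1\<close> and 256 for
  \<open>r = 2\<close>, where every such pair involves \<open>r\<close>; hence \<open>r1\<close> and
  \<open>r2\<close>.\<close>

lemma partial_realization_C0:
  assumes k: "\<And>x y z. P x y z \<Longrightarrow> k x y z \<in> C0" and X: "open_convex 3 (region P)"
    and I: "\<And>i. i \<in> {1,2,3,4,5,6} \<Longrightarrow> i \<noteq> r \<Longrightarrow> open_convex 3 (region (\<lambda>x y z. P x y z \<and> i \<in> k x y z))"
    and r1: "r = 1 \<Longrightarrow> open_convex 3 (region (\<lambda>x y z. P x y z \<and> 1 \<in> k x y z \<and> 4 \<in> k x y z))"
    and r2: "r = 2 \<Longrightarrow> open_convex 3 (region (\<lambda>x y z. P x y z \<and> 2 \<in> k x y z \<and> 6 \<in> k x y z))"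
  shows "partial_realization C0 (Tk C0 {r}) (region P) (word_at k)"
proof -
  let ?pre = "\<lambda>T. {p \<in> region P. word_at k p \<in> T}"
  have word: "word_at k p \<in> C0" if "p \<in> region P" for p
    using that k by (simp add: region_def word_at_def)
  have single: "open_convex 3 (?pre (Tk C0 {i}))" if "i \<in> {1,2,3,4,5,6}" "i \<noteq> r" for i
  proof -
    have "?pre (Tk C0 {i}) = region (\<lambda>x y z. P x y z \<and> i \<in> k x y z)"
      using k by (auto simp: region_def word_at_def Tk_def)
    then show ?thesis using I that by simp
  qed
  have pair: "open_convex 3 {p \<in> region P. i \<in> word_at k p \<and> j \<in> word_at k p}"
    if "i \<in> {1,2,3,4,5,6}" "i \<noteq> r" "j \<in> {1,2,3,4,5,6}" "j \<noteq> r" for i j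
  proof -
    have "{p \<in> region P. i \<in> word_at k p \<and> j \<in> word_at k p} = ?pre (Tk C0 {i}) \<inter> ?pre (Tk C0 {j})"
      using word by (auto simp: Tk_def)
    then show ?thesis using open_convex_Int single that by simp
  qed
  have codeword: "?pre {c} = {p \<in> region P. i \<in> word_at k p \<and> j \<in> word_at k p}"
    if "\<And>w. w \<in> C0 \<Longrightarrow> w = c \<longleftrightarrow> i \<in> w \<and> j \<in> w" for c i j
    using that[OF word] by blast
  have "open_convex 3 (?pre T)" if "trunk C0 T" "T \<noteq> Tk C0 {r}" for T
  proof -
    have "?pre C0 = region P" using word by blast
    then have C0: "open_convex 3 (?pre C0)" using X by simp
    have empty: "open_convex 3 (?pre {})" by (simp add: open_convex_empty)
    have 123: "open_convex 3 (?pre {{1,2,3}})"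
    proof (cases "r = 2")
      case True
      then show ?thesis using pair[of 1 3] codeword[of "{1,2,3}" 1 3, OF C0_word_iff(3)] by simp
    next
      case False
      show ?thesis
      proof (cases "r = 1")
        case True
        then show ?thesis using pair[of 2 3] codeword[of "{1,2,3}" 2 3, OF C0_word_iff(1)] by simp
      next
        case r1: False
        then show ?thesis using pair[of 1 2] False codeword[of "{1,2,3}" 1 2, OF C0_word_iff(2)] by simp
      qed
    qed
    have 145: "open_convex 3 (?pre {{1,4,5}})"
    proof (cases "r = 1")
      case True
      have "{p \<in> region P. 1 \<in> word_at k p \<and> 4 \<in> word_at k p} = region (\<lambda>x y z. P x y z \<and> 1 \<in> k x y z \<and> 4 \<in> k x y z)"
        by (auto simp: region_def word_at_def)
      with codeword[of "{1,4,5}" 1 4, OF C0_word_iff(4)]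
      have "?pre {{1,4,5}} = region (\<lambda>x y z. P x y z \<and> 1 \<in> k x y z \<and> 4 \<in> k x y z)"
        by (rule trans)
      then show ?thesis using r1[OF True] by simp
    next
      case r1: False
      show ?thesis
      proof (cases "r = 4")
        case True
        then show ?thesis using pair[of 1 5] codeword[of "{1,4,5}" 1 5, OF C0_word_iff(5)] by simp
      next
        case False
        then show ?thesis using pair[of 1 4] r1 codeword[of "{1,4,5}" 1 4, OF C0_word_iff(4)] by simp
      qed
    qed
    have 256: "open_convex 3 (?pre {{2,5,6}})"
    proof (cases "r = 2")
      case True
      have "{p \<in> region P. 2 \<in> word_at k p \<and> 6 \<in> word_at k p} = region (\<lambda>x y z. P x y z \<and> 2 \<in> k x y z \<and> 6 \<in> k x y z)"
        by (auto simp: region_def word_at_def)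
      with codeword[of "{2,5,6}" 2 6, OF C0_word_iff(6)]
      have "?pre {{2,5,6}} = region (\<lambda>x y z. P x y z \<and> 2 \<in> k x y z \<and> 6 \<in> k x y z)"
        by (rule trans)
      then show ?thesis using r2[OF True] by simp
    next
      case r2: False
      show ?thesis
      proof (cases "r = 6")
        case True
        then show ?thesis using pair[of 2 5] codeword[of "{2,5,6}" 2 5, OF C0_word_iff(7)] by simp
      next
        case False
        then show ?thesis using pair[of 2 6] r2 codeword[of "{2,5,6}" 2 6, OF C0_word_iff(6)] by simp
      qed
    qed
    have 3456: "open_convex 3 (?pre {{3,4,5,6}})"
    proof (cases "r = 4")
      case True
      then show ?thesis using pair[of 3 6] codeword[of "{3,4,5,6}" 3 6, OF C0_word_iff(10)] by simp
    next
      case r4: False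
      show ?thesis
      proof (cases "r = 6")
        case True
        then show ?thesis using pair[of 3 4] codeword[of "{3,4,5,6}" 3 4, OF C0_word_iff(9)] by simp
      next
        case False
        then show ?thesis using pair[of 4 6] r4 codeword[of "{3,4,5,6}" 4 6, OF C0_word_iff(8)] by simp
      qed
    qed
    have Tk: "open_convex 3 (?pre (Tk C0 {i}))" if "T = Tk C0 {i}" "i \<in> {1,2,3,4,5,6}" for i
      using single[OF that(2)] that \<open>T \<noteq> Tk C0 {r}\<close> by blast
    from trunk_C0_cases[OF that(1)] show ?thesis
      unfolding insert_iff empty_iff
      by (elim disjE)
        (simp_all only: empty C0 123 145 256 3456, (rule Tk; simp only: insert_iff simp_thms)+)
  qed
  then show ?thesis
    unfolding partial_realization_def using X word
    by (intro exI[of _ 3]) blast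
qed

section \<open>Explicit partial realizations of \<open>C0\<close>\<close>

lemma in_C0:
  "{3,4,5,6} \<in> C0" "{1,2,3} \<in> C0" "{1,4,5} \<in> C0" "{2,5,6} \<in> C0" "{4,5} \<in> C0" "{5,6} \<in> C0"
  "{1} \<in> C0" "{2} \<in> C0" "{3} \<in> C0" "{} \<in> C0"
  by (simp_all add: C0_def)

lemma C0_cases:
  "c \<in> C0 \<Longrightarrow> c = {3,4,5,6} \<or> c = {1,2,3} \<or> c = {1,4,5} \<or> c = {2,5,6} \<or> c = {4,5} \<or> c = {5,6}
    \<or> c = {1} \<or> c = {2} \<or> c = {3} \<or> c = {}"
  by (simp only: C0_def insert_iff empty_iff simp_thms)

text \<open>A planar picture, constant in z. Neuron 5 is the strip 0 < y < 1, covered by 4 and 6,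
  which overlap where the vertical strip of 3 crosses it. Neuron 2 is the half-plane x + y > 4.
  Neuron 1 is split between the left end of the horizontal strip (145) and the upper part of the
  vertical one (123).\<close>

lemma realization_without_1:
  "\<exists>X \<kappa>. partial_realization C0 (Tk C0 {1}) X \<kappa> \<and> C0 - {{1}} \<subseteq> \<kappa> ` X"
proof -
  define k :: "real \<Rightarrow> real \<Rightarrow> real \<Rightarrow> nat set" where "k = (\<lambda>x y z.
    if y < 1 then
      if x < 0 then {1,4,5} else if x \<le> 1 then {4,5} else if x < 2 then {3,4,5,6}
      else if x + y \<le> 4 then {5,6} else {2,5,6}
    else if 1 < x \<and> x < 2 then if x + y \<le> 4 then {3} else {1,2,3}
    else if x + y \<le> 4 then {} else {2})"
  define P :: "real \<Rightarrow> real \<Rightarrow> real \<Rightarrow> bool" where "P = (\<lambda>x y z. 0 < y)"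
  have k: "4 \<in> k x y z \<longleftrightarrow> y < 1 \<and> x < 2" "5 \<in> k x y z \<longleftrightarrow> y < 1" "6 \<in> k x y z \<longleftrightarrow> y < 1 \<and> 1 < x"
    "3 \<in> k x y z \<longleftrightarrow> 1 < x \<and> x < 2" "2 \<in> k x y z \<longleftrightarrow> 4 < x + y" for x y z
    by (auto simp: k_def)
  have k_pair: "1 \<in> k x y z \<and> 4 \<in> k x y z \<longleftrightarrow> y < 1 \<and> x < 0" for x y z
    by (auto simp: k_def)
  have "partial_realization C0 (Tk C0 {1}) (region P) (word_at k)"
  proof (rule partial_realization_C0)
    show "k x y z \<in> C0" for x y z by (simp add: k_def in_C0 del: One_nat_def)
    show "open_convex 3 (region P)" unfolding P_def by (intro open_convex_region_intros)
    show "open_convex 3 (region (\<lambda>x y z. P x y z \<and> i \<in> k x y z))"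
      if "i \<in> {1,2,3,4,5,6}" "i \<noteq> 1" for i
      using that unfolding insert_iff empty_iff P_def
      by (elim disjE) (simp_all only: k simp_thms, (intro open_convex_region_intros)+)
    show "open_convex 3 (region (\<lambda>x y z. P x y z \<and> 1 \<in> k x y z \<and> 4 \<in> k x y z))"
      unfolding k_pair P_def by (intro open_convex_region_intros)
  qed simp
  moreover have "C0 - {{1}} \<subseteq> word_at k ` region P"
  proof
    fix c assume "c \<in> C0 - {{1}}"
    then have "c \<in> C0" "c \<noteq> {1}" by simp_all
    then have "c = {3,4,5,6} \<or> c = {1,2,3} \<or> c = {1,4,5} \<or> c = {2,5,6} \<or> c = {4,5} \<or> c = {5,6}
      \<or> c = {2} \<or> c = {3} \<or> c = {}"
      using C0_cases[of c] by argo
    then show "c \<in> word_at k ` region P"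
      using region_point[of P "3/2" "1/2" 0 k] region_point[of P "3/2" 10 0 k]
        region_point[of P "-1" "1/2" 0 k] region_point[of P 10 "1/2" 0 k]
        region_point[of P "1/2" "1/2" 0 k] region_point[of P 2 "1/2" 0 k]
        region_point[of P 4 4 0 k] region_point[of P "3/2" 1 0 k] region_point[of P 0 2 0 k]
      by (elim disjE) (simp_all add: k_def P_def)
  qed
  ultimately show ?thesis by blast
qed

text \<open>The image of the previous picture under the symmetry of \<open>C0\<close> that swaps 1
  with 2 and 4 with 6.\<close>

lemma realization_without_2:
  "\<exists>X \<kappa>. partial_realization C0 (Tk C0 {2}) X \<kappa> \<and> C0 - {{2}} \<subseteq> \<kappa> ` X"
proof -
  define k :: "real \<Rightarrow> real \<Rightarrow> real \<Rightarrow> nat set" where "k = (\<lambda>x y z.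
    if y < 1 then
      if x < 0 then {2,5,6} else if x \<le> 1 then {5,6} else if x < 2 then {3,4,5,6}
      else if x + y \<le> 4 then {4,5} else {1,4,5}
    else if 1 < x \<and> x < 2 then if x + y \<le> 4 then {3} else {1,2,3}
    else if x + y \<le> 4 then {} else {1})"
  define P :: "real \<Rightarrow> real \<Rightarrow> real \<Rightarrow> bool" where "P = (\<lambda>x y z. 0 < y)"
  have k: "6 \<in> k x y z \<longleftrightarrow> y < 1 \<and> x < 2" "5 \<in> k x y z \<longleftrightarrow> y < 1" "4 \<in> k x y z \<longleftrightarrow> y < 1 \<and> 1 < x"
    "3 \<in> k x y z \<longleftrightarrow> 1 < x \<and> x < 2" "1 \<in> k x y z \<longleftrightarrow> 4 < x + y" for x y z
    by (auto simp: k_def)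
  have k_pair: "2 \<in> k x y z \<and> 6 \<in> k x y z \<longleftrightarrow> y < 1 \<and> x < 0" for x y z
    by (auto simp: k_def)
  have "partial_realization C0 (Tk C0 {2}) (region P) (word_at k)"
  proof (rule partial_realization_C0)
    show "k x y z \<in> C0" for x y z by (simp add: k_def in_C0 del: One_nat_def)
    show "open_convex 3 (region P)" unfolding P_def by (intro open_convex_region_intros)
    show "open_convex 3 (region (\<lambda>x y z. P x y z \<and> i \<in> k x y z))"
      if "i \<in> {1,2,3,4,5,6}" "i \<noteq> 2" for i
      using that unfolding insert_iff empty_iff P_def
      by (elim disjE) (simp_all only: k simp_thms, (intro open_convex_region_intros)+)
    show "open_convex 3 (region (\<lambda>x y z. P x y z \<and> 2 \<in> k x y z \<and> 6 \<in> k x y z))"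
      unfolding k_pair P_def by (intro open_convex_region_intros)
  qed simp
  moreover have "C0 - {{2}} \<subseteq> word_at k ` region P"
  proof
    fix c assume "c \<in> C0 - {{2}}"
    then have "c \<in> C0" "c \<noteq> {2}" by simp_all
    then have "c = {3,4,5,6} \<or> c = {1,2,3} \<or> c = {1,4,5} \<or> c = {2,5,6} \<or> c = {4,5} \<or> c = {5,6}
      \<or> c = {1} \<or> c = {3} \<or> c = {}"
      using C0_cases[of c] by argo
    then show "c \<in> word_at k ` region P"
      using region_point[of P "3/2" "1/2" 0 k] region_point[of P "3/2" 10 0 k]
        region_point[of P "-1" "1/2" 0 k] region_point[of P 10 "1/2" 0 k]
        region_point[of P "1/2" "1/2" 0 k] region_point[of P 2 "1/2" 0 k]
        region_point[of P 4 4 0 k] region_point[of P "3/2" 1 0 k] region_point[of P 0 2 0 k]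
      by (elim disjE) (simp_all add: k_def P_def)
  qed
  ultimately show ?thesis by blast
qed

text \<open>In the positive quadrant, neurons 1 and 2 are strips along the axes that cross in the
  unit square, and 5 is the half-plane x + y > 2 beyond it. Neuron 3 is split between that square
  (123) and the quadrant x > 1, y > 1 (3456).\<close>

lemma realization_without_3:
  "\<exists>X \<kappa>. partial_realization C0 (Tk C0 {3}) X \<kappa> \<and> C0 - {{3}} \<subseteq> \<kappa> ` X"
proof -
  define k :: "real \<Rightarrow> real \<Rightarrow> real \<Rightarrow> nat set" where "k = (\<lambda>x y z.
    if x + y \<le> 2 then
      if x < 1 then if y < 1 then {1,2,3} else {1} else if y < 1 then {2} else {}
    else if x < 1 then {1,4,5} else if y < 1 then {2,5,6}
    else if x = 1 then {4,5} else if y = 1 then {5,6} else {3,4,5,6})"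
  define P :: "real \<Rightarrow> real \<Rightarrow> real \<Rightarrow> bool" where "P = (\<lambda>x y z. 0 < x \<and> 0 < y)"
  have k: "1 \<in> k x y z \<longleftrightarrow> x < 1" "2 \<in> k x y z \<longleftrightarrow> y < 1" "5 \<in> k x y z \<longleftrightarrow> 2 < x + y"
    "4 \<in> k x y z \<longleftrightarrow> 2 < x + y \<and> 1 < y" "6 \<in> k x y z \<longleftrightarrow> 2 < x + y \<and> 1 < x" for x y z
    by (auto simp: k_def)
  have "partial_realization C0 (Tk C0 {3}) (region P) (word_at k)"
  proof (rule partial_realization_C0)
    show "k x y z \<in> C0" for x y z by (simp add: k_def in_C0 del: One_nat_def)
    show "open_convex 3 (region P)" unfolding P_def by (intro open_convex_region_intros)
    show "open_convex 3 (region (\<lambda>x y z. P x y z \<and> i \<in> k x y z))"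
      if "i \<in> {1,2,3,4,5,6}" "i \<noteq> 3" for i
      using that unfolding insert_iff empty_iff P_def
      by (elim disjE) (simp_all only: k simp_thms, (intro open_convex_region_intros)+)
  qed simp_all
  moreover have "C0 - {{3}} \<subseteq> word_at k ` region P"
  proof
    fix c assume "c \<in> C0 - {{3}}"
    then have "c \<in> C0" "c \<noteq> {3}" by simp_all
    then have "c = {3,4,5,6} \<or> c = {1,2,3} \<or> c = {1,4,5} \<or> c = {2,5,6} \<or> c = {4,5} \<or> c = {5,6}
      \<or> c = {1} \<or> c = {2} \<or> c = {}"
      using C0_cases[of c] by argo
    \<comment> \<open>The words 45 and 56 occur only on the lines x = 1 and y = 1, and the empty
      word only at (1,1).\<close>
    then show "c \<in> word_at k ` region P"
      using region_point[of P 2 2 0 k] region_point[of P "1/2" "1/2" 0 k]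
        region_point[of P "1/2" 3 0 k] region_point[of P 3 "1/2" 0 k]
        region_point[of P 1 5 0 k] region_point[of P 5 1 0 k]
        region_point[of P "1/2" 1 0 k] region_point[of P 1 "1/2" 0 k] region_point[of P 1 1 0 k]
      by (elim disjE) (simp_all add: k_def P_def)
  qed
  ultimately show ?thesis by blast
qed

text \<open>The ideal label where \<open>1 \<le> x\<close>, \<open>1 \<le> y\<close>, \<open>3 < x + y + z\<close> would be \<open>{5}\<close>, which is not in \<open>C0\<close>; its
  substitute \<open>w\<close> decides which of the neurons 4, 5, 6 loses its convex set.\<close>

definition tripod_word :: "nat set \<Rightarrow> real \<Rightarrow> real \<Rightarrow> real \<Rightarrow> nat set" where
  "tripod_word w x y z =
    (if x + y + z \<le> 3 then
      if y < 1 \<and> z < 1 then if x < 1 then {1,2,3} else {1}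
      else if x < 1 \<and> z < 1 then {2} else if x < 1 \<and> y < 1 then {3} else {}
    else if x < 1 then if y < 1 then {3,4,5,6} else if z < 1 then {2,5,6} else {5,6}
    else if y < 1 then if z < 1 then {1,4,5} else {4,5} else w)"

text \<open>Each hypothesis says that \<open>w\<close> agrees with the ideal label
  \<open>{5}\<close> on the neurons in question.\<close>

lemma tripod_word_iff:
  "w \<inter> {1,2,3} = {} \<Longrightarrow> 1 \<in> tripod_word w x y z \<longleftrightarrow> y < 1 \<and> z < 1"
  "w \<inter> {1,2,3} = {} \<Longrightarrow> 2 \<in> tripod_word w x y z \<longleftrightarrow> x < 1 \<and> z < 1"
  "w \<inter> {1,2,3} = {} \<Longrightarrow> 3 \<in> tripod_word w x y z \<longleftrightarrow> x < 1 \<and> y < 1"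
  "4 \<notin> w \<Longrightarrow> 4 \<in> tripod_word w x y z \<longleftrightarrow> 3 < x + y + z \<and> y < 1"
  "5 \<in> w \<Longrightarrow> 5 \<in> tripod_word w x y z \<longleftrightarrow> 3 < x + y + z"
  "6 \<notin> w \<Longrightarrow> 6 \<in> tripod_word w x y z \<longleftrightarrow> 3 < x + y + z \<and> x < 1"
  by (auto simp: tripod_word_def)

text \<open>In the positive octant, neurons 1, 2, 3 are square prisms along the x, y, z axes,
  meeting pairwise in the unit cube, which the half-space x + y + z > 3 misses. All ten codewords
  occur as labels.\<close>

lemma realization_without_456:
  fixes w :: "nat set" and r :: nat
  assumes "r = 4 \<and> w = {4,5} \<or> r = 5 \<and> w = {} \<or> r = 6 \<and> w = {5,6}"
  shows "\<exists>X \<kappa>. partial_realization C0 (Tk C0 {r}) X \<kappa> \<and> C0 \<subseteq> \<kappa> ` X"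
proof -
  define P :: "real \<Rightarrow> real \<Rightarrow> real \<Rightarrow> bool" where "P = (\<lambda>x y z. 0 < x \<and> 0 < y \<and> 0 < z)"
  have w: "w \<in> C0" "w \<inter> {1,2,3} = {}"
    using assms by (elim disjE; simp add: in_C0)+
  have w': "r \<noteq> 4 \<Longrightarrow> 4 \<notin> w" "r \<noteq> 5 \<Longrightarrow> 5 \<in> w" "r \<noteq> 6 \<Longrightarrow> 6 \<notin> w"
    using assms by (elim disjE; simp)+
  let ?k = "tripod_word w"
  have "partial_realization C0 (Tk C0 {r}) (region P) (word_at ?k)"
  proof (rule partial_realization_C0)
    show "?k x y z \<in> C0" for x y z using w(1) by (simp add: tripod_word_def in_C0 del: One_nat_def)
    show "open_convex 3 (region P)" unfolding P_def by (intro open_convex_region_intros)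
    show "open_convex 3 (region (\<lambda>x y z. P x y z \<and> i \<in> ?k x y z))"
      if "i \<in> {1,2,3,4,5,6}" "i \<noteq> r" for i
    proof -
      from that(1) consider "i = 1" | "i = 2" | "i = 3" | "i = 4" | "i = 5" | "i = 6" by blast
      then show ?thesis
      proof cases
        case 4
        then have "4 \<notin> w" using w' that(2) by simp
        then show ?thesis unfolding 4 tripod_word_iff(4)[OF \<open>4 \<notin> w\<close>] P_def by (intro open_convex_region_intros)
      next
        case 5
        then have "5 \<in> w" using w' that(2) by simp
        then show ?thesis unfolding 5 tripod_word_iff(5)[OF \<open>5 \<in> w\<close>] P_def by (intro open_convex_region_intros)
      next
        case 6
        then have "6 \<notin> w" using w' that(2) by simp
        then show ?thesis unfolding 6 tripod_word_iff(6)[OF \<open>6 \<notin> w\<close>] P_def by (intro open_convex_region_intros)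
      qed (simp_all only: tripod_word_iff(1-3)[OF w(2)] P_def, (intro open_convex_region_intros)+)
    qed
  qed (use assms in \<open>elim disjE; simp\<close>)+
  moreover have "C0 \<subseteq> word_at ?k ` region P"
  proof
    fix c assume "c \<in> C0"
    from C0_cases[OF this] show "c \<in> word_at ?k ` region P"
      using region_point[of P "1/2" "1/2" 5 ?k] region_point[of P "1/2" "1/2" "1/2" ?k]
        region_point[of P 5 "1/2" "1/2" ?k] region_point[of P "1/2" 5 "1/2" ?k]
        region_point[of P 5 "1/2" 5 ?k] region_point[of P "1/2" 5 5 ?k]
        region_point[of P 1 "1/2" "1/2" ?k] region_point[of P "1/2" 1 "1/2" ?k]
        region_point[of P "1/2" "1/2" 1 ?k] region_point[of P 1 1 "1/2" ?k]
      by (elim disjE) (simp_all add: tripod_word_def P_def)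
  qed
  ultimately show ?thesis by blast
qed

section \<open>Minimality\<close>

lemma C0_is_code: "C0 \<subseteq> Pow {1,2,3,4,5,6}" "is_code C0"
proof -
  show *: "C0 \<subseteq> Pow {1,2,3,4,5,6}" by (simp add: C0_def)
  have "{1,2,3,4,5,6} \<subseteq> {1..6::nat}" by simp
  with * show "is_code C0" unfolding is_code_def by blast
qed

text \<open>The realization without 5 handles every trunk that does not contain that of 5. The only
  other proper trunk is that of 5 itself, which lacks \<open>{1}\<close> and so is handled by the
  realization without 1.\<close>

lemma convex_proper_trunk_C0:
  assumes T: "trunk C0 T" "T \<subset> C0"
  shows "convex_code T"
proof (cases "Tk C0 {5} \<subseteq> T")
  case False
  obtain X \<kappa> where "partial_realization C0 (Tk C0 {5}) X \<kappa>" "C0 \<subseteq> \<kappa> ` X"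
    using realization_without_456[of 5 "{}"] by blast
  moreover have "T \<subseteq> \<kappa> ` X" using T(2) calculation(2) by blast
  ultimately show ?thesis
    using convex_trunk_if_partial_realization[OF _ C0_is_code(2) T(1) False] by simp
next
  case True
  have "{4,5} \<in> Tk C0 {5}" "{5,6} \<in> Tk C0 {5}" unfolding Tk_C0 by simp_all
  with True have 456: "{4,5} \<in> T" "{5,6} \<in> T" by auto
  then obtain \<sigma> where \<sigma>: "T = Tk C0 \<sigma>" using T(1) unfolding trunk_def by blast
  \<comment> \<open>As \<open>\<sigma>\<close> lies in both 45 and 56 and is not empty, it is
    \<open>{5}\<close>.\<close>
  have "\<sigma> \<subseteq> {4,5}" "\<sigma> \<subseteq> {5,6}" using 456 unfolding \<sigma> Tk_def by simp_all
  moreover have "\<sigma> \<noteq> {}" using T(2) unfolding \<sigma> Tk_def by auto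
  ultimately have "5 \<in> \<sigma>" by auto
  then have "{1} \<notin> T" unfolding \<sigma> Tk_def by auto
  moreover have "{1} \<in> Tk C0 {1}" unfolding Tk_C0 by simp
  ultimately have R: "\<not> Tk C0 {1} \<subseteq> T" by blast
  obtain X \<kappa> where X: "partial_realization C0 (Tk C0 {1}) X \<kappa>" "C0 - {{1}} \<subseteq> \<kappa> ` X"
    using realization_without_1 by blast
  have "T \<subseteq> \<kappa> ` X" using T(2) \<open>{1} \<notin> T\<close> X(2) by blast
  then show ?thesis
    by (rule convex_trunk_if_partial_realization[OF X(1) C0_is_code(2) T(1) R])
qed

text \<open>Hence a realization that omits the codeword \<open>{r}\<close> may use points labelled \<open>{}\<close> in its place.\<close>

lemma empty_in_trunk_iff_singleton:
  assumes "trunk C T" "T \<noteq> Tk C {r}" "{} \<in> C" "{r} \<in> C"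
  shows "{} \<in> T \<longleftrightarrow> {r} \<in> T"
proof (cases "T = {}")
  case False
  then obtain \<sigma> where \<sigma>: "T = Tk C \<sigma>" using assms(1) unfolding trunk_def by blast
  then have "\<sigma> \<noteq> {r}" using assms(2) by blast
  then have "\<sigma> \<subseteq> {r} \<longleftrightarrow> \<sigma> \<subseteq> {}" by (simp add: subset_singleton_iff)
  then show ?thesis using assms(3,4) by (simp only: \<sigma> Tk_def mem_Collect_eq simp_thms)
qed simp

text \<open>A non-isomorphic image omits the simple trunk of some \<open>r\<close>, and the partial
  realization without \<open>r\<close> composed with \<open>f\<close> realizes it.\<close>

lemma convex_proper_image_C0:
  assumes f: "code_morphism C0 D f" "is_code D" and niso: "\<not> code_isomorphic C0 (f ` C0)"
  shows "convex_code (f ` C0)"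
proof -
  obtain r where r: "r \<in> {1,2,3,4,5,6}" and R: "\<And>j. {c \<in> C0. j \<in> f c} \<noteq> Tk C0 {r}"
    using code_isomorphic_image[OF f(1) _ C0_is_code(1)] niso by blast
  consider "r \<in> {4,5,6}" | "r \<in> {1,2,3}" using r by blast
  then show ?thesis
  proof cases
    case 1
    then have "\<exists>w. r = 4 \<and> w = {4,5} \<or> r = 5 \<and> w = {} \<or> r = 6 \<and> w = {5,6::nat}" by auto
    then obtain w where "r = 4 \<and> w = {4,5} \<or> r = 5 \<and> w = {} \<or> r = 6 \<and> w = {5,6::nat}" ..
    from realization_without_456[OF this]
    obtain X \<kappa> where X: "partial_realization C0 (Tk C0 {r}) X \<kappa>" "C0 \<subseteq> \<kappa> ` X" by blast
    show ?thesis
    proof (rule convex_image_if_partial_realization[OF X(1) f R])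
      fix c assume "c \<in> C0"
      then obtain x where "x \<in> X" "\<kappa> x = c" using X(2) by blast
      then show "\<exists>x\<in>X. \<forall>T. trunk C0 T \<longrightarrow> T \<noteq> Tk C0 {r} \<longrightarrow> (\<kappa> x \<in> T \<longleftrightarrow> c \<in> T)" by blast
    qed
  next
    case 2
    then have r: "r = 1 \<or> r = 2 \<or> r = 3" by simp
    then have "\<exists>X \<kappa>. partial_realization C0 (Tk C0 {r}) X \<kappa> \<and> C0 - {{r}} \<subseteq> \<kappa> ` X"
      by (elim disjE)
        (simp_all only: realization_without_1 realization_without_2 realization_without_3)
    then obtain X \<kappa> where X: "partial_realization C0 (Tk C0 {r}) X \<kappa>" "C0 - {{r}} \<subseteq> \<kappa> ` X"
      by blast
    have "{r} \<in> C0" using r by (elim disjE) (simp_all only: in_C0)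
    show ?thesis
    proof (rule convex_image_if_partial_realization[OF X(1) f R])
      fix c assume "c \<in> C0"
      show "\<exists>x\<in>X. \<forall>T. trunk C0 T \<longrightarrow> T \<noteq> Tk C0 {r} \<longrightarrow> (\<kappa> x \<in> T \<longleftrightarrow> c \<in> T)"
      proof (cases "c = {r}")
        case True
        \<comment> \<open>The label \<open>{r}\<close> is missing here; the empty word stands in for
          it, since only the omitted trunk tells the two apart.\<close>
        have "{} \<in> C0 - {{r}}" using in_C0(10) by simp
        then obtain x where "x \<in> X" "\<kappa> x = {}" using X(2) by (metis imageE subsetD)
        then have "\<kappa> x \<in> T \<longleftrightarrow> c \<in> T" if "trunk C0 T" "T \<noteq> Tk C0 {r}" for T
          using empty_in_trunk_iff_singleton[OF that in_C0(10) \<open>{r} \<in> C0\<close>] True by simp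
        then show ?thesis using \<open>x \<in> X\<close> by blast
      next
        case False
        then have "c \<in> C0 - {{r}}" using \<open>c \<in> C0\<close> by simp
        then obtain x where "x \<in> X" "\<kappa> x = c" using X(2) by (metis imageE subsetD)
        then show ?thesis by blast
      qed
    qed
  qed
qed

theorem theorem5p7:
  shows "minimally_non_convex C0 \<and> (\<forall>\<sigma>. \<not> local_obstruction C0 \<sigma>)
         \<and> (\<forall>\<sigma>. \<not> local_obstruction_2nd C0 \<sigma>)"
proof (intro conjI allI)
  show "minimally_non_convex C0"
    unfolding minimally_non_convex_def
    using C0_not_convex convex_proper_trunk_C0 convex_proper_image_C0 by metis
  show "\<not> local_obstruction C0 \<sigma>" for \<sigma>
    unfolding local_obstruction_def using links_of_missing_faces_C0(1) by blast
  show "\<not> local_obstruction_2nd C0 \<sigma>" for \<sigma>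
    unfolding local_obstruction_2nd_def using links_of_missing_faces_C0(2) by blast
qed

end
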